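(* Let $1\leq p<\infty$ and $f\in\mathscr{D}(\mathcal{T}_{\max,p})$. Then $|f|^p\in\mathscr{D}(\mathcal{T}_{\max,1})$ and $$\mathcal{T}_{\max,1}|f|^p=p\,\mathrm{sign}(f)\,|f|^{p-1}\,\mathcal{T}_{\max,p}f,$$ where $\mathrm{sign}(f)(x)=1$ if $f(x)>0$ and $\mathrm{sign}(f)(x)=-1$ if $f(x)<0$ ($x\in\Omega$), and $\mathrm{sign}(f)(x)=0$ if $f(x)=0$.
   Context: Setting. $\mathbb{R}^N$ is endowed with a positive Radon measure $\mu$, $\Omega\subset\mathbb{R}^N$ is a sufficiently smooth open set, $\mathscr{F}:\mathbb{R}^N\to\mathbb{R}^N$ is a globally Lipschitz vector field, and $\Phi:\mathbb{R}^N\times\mathbb{R}\to\mathbb{R}^N$ is its flow: $t\mapsto\Phi(x,t)$ is the unique solution of $\dot{\mathbf X}=\mathscr{F}(\mathbf X)$, $\mathbf X(0)=x$. With $T_t=\Phi(\cdot,t)$, it is assumed that $\mu(T_tA)=\mu(A)$ for all measurable $A\subset\mathbb{R}^N$ and all $t\in\mathbb{R}$. Functions are real-valued. For $x\in\Omega$, $\tau_\pm(x)=\inf\{s>0:\Phi(x,\pm s)\notin\Omega\}$ ($\inf\varnothing=\infty$). Test functions: $\mathfrak{Y}$ is the set of measurable bounded $\psi:\Omega\to\mathbb{R}$ with compact support in $\Omega$ such that for any $x\in\Omega$ the map $s\in(-\tau_-(x),\tau_+(x))\mapsto\psi(\Phi(x,s))$ is $C^1$ and $x\mapsto\frac{d}{ds}\psi(\Phi(x,s))|_{s=0}$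 is measurable and bounded. For $1\leq p<\infty$, $\mathscr{D}(\mathcal{T}_{\max,p})$ is the set of $f\in L^p(\Omega,\mu)$ for which there is $g\in L^p(\Omega,\mu)$ with $\int_\Omega g\psi\,d\mu=\int_\Omega f(x)\frac{d}{ds}\psi(\Phi(x,s))|_{s=0}\,d\mu(x)$ for all $\psi\in\mathfrak{Y}$; then $\mathcal{T}_{\max,p}f:=g$. *)

theory Defs
  imports "HOL-Analysis.Analysis"
begin

definition radon_measure :: "(real ^ 'n) measure \<Rightarrow> bool" where
  "radon_measure \<mu> \<longleftrightarrow>
     sets \<mu> = sets borel \<and>
     (\<forall>K. compact K \<longrightarrow> emeasure \<mu> K < \<infinity>) \<and>
     (\<forall>A\<in>sets \<mu>. emeasure \<mu> A = (SUP K\<in>{K. compact K \<and> K \<subseteq> A}. emeasure \<mu> K))"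

definition solves_ivp :: "(real ^ 'n \<Rightarrow> real ^ 'n) \<Rightarrow> real ^ 'n \<Rightarrow> (real \<Rightarrow> real ^ 'n) \<Rightarrow> bool" where
  "solves_ivp F x X \<longleftrightarrow> X 0 = x \<and> (\<forall>t. (X has_vector_derivative F (X t)) (at t))"

definition flow_of :: "(real ^ 'n \<Rightarrow> real ^ 'n) \<Rightarrow> (real ^ 'n \<Rightarrow> real \<Rightarrow> real ^ 'n) \<Rightarrow> bool" where
  "flow_of F \<Phi> \<longleftrightarrow> (\<forall>x. solves_ivp F x (\<Phi> x) \<and> (\<forall>X. solves_ivp F x X \<longrightarrow> X = \<Phi> x))"

definition flow_invariant :: "(real ^ 'n) measure \<Rightarrow> (real ^ 'n \<Rightarrow> real \<Rightarrow> real ^ 'n) \<Rightarrow> bool" where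
  "flow_invariant \<mu> \<Phi> \<longleftrightarrow>
     (\<forall>t. \<forall>A\<in>sets \<mu>. emeasure \<mu> ((\<lambda>x. \<Phi> x t) ` A) = emeasure \<mu> A)"

definition tau_plus :: "(real ^ 'n) set \<Rightarrow> (real ^ 'n \<Rightarrow> real \<Rightarrow> real ^ 'n) \<Rightarrow> real ^ 'n \<Rightarrow> ereal" where
  "tau_plus \<Omega> \<Phi> x = (INF s\<in>{s. 0 < s \<and> \<Phi> x s \<notin> \<Omega>}. ereal s)"

definition tau_minus :: "(real ^ 'n) set \<Rightarrow> (real ^ 'n \<Rightarrow> real \<Rightarrow> real ^ 'n) \<Rightarrow> real ^ 'n \<Rightarrow> ereal" where
  "tau_minus \<Omega> \<Phi> x = (INF s\<in>{s. 0 < s \<and> \<Phi> x (- s) \<notin> \<Omega>}. ereal s)"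

definition flow_deriv :: "(real ^ 'n \<Rightarrow> real \<Rightarrow> real ^ 'n) \<Rightarrow> (real ^ 'n \<Rightarrow> real) \<Rightarrow> real ^ 'n \<Rightarrow> real" where
  "flow_deriv \<Phi> \<psi> x = deriv (\<lambda>s. \<psi> (\<Phi> x s)) 0"

(* Functions on \<Omega> are represented by total functions whose values outside \<Omega> are irrelevant:
   everything below depends only on the restriction to \<Omega>. In particular the support is the closure
   of the nonvanishing set inside \<Omega>; it is compact in \<Omega> iff its closure in the whole space
   is compact and contained in \<Omega>. *)
definition test_functions ::
  "(real ^ 'n) measure \<Rightarrow> (real ^ 'n) set \<Rightarrow> (real ^ 'n \<Rightarrow> real \<Rightarrow> real ^ 'n) \<Rightarrow> (real ^ 'n \<Rightarrow> real) set" where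
  "test_functions \<mu> \<Omega> \<Phi> =
     {\<psi>. set_borel_measurable \<mu> \<Omega> \<psi> \<and> bounded (\<psi> ` \<Omega>) \<and>
          compact (closure {x\<in>\<Omega>. \<psi> x \<noteq> 0}) \<and> closure {x\<in>\<Omega>. \<psi> x \<noteq> 0} \<subseteq> \<Omega> \<and>
          (\<forall>x\<in>\<Omega>. (\<lambda>s. \<psi> (\<Phi> x s)) C1_differentiable_on
                     {s. - tau_minus \<Omega> \<Phi> x < ereal s \<and> ereal s < tau_plus \<Omega> \<Phi> x}) \<and>
          set_borel_measurable \<mu> \<Omega> (flow_deriv \<Phi> \<psi>) \<and> bounded (flow_deriv \<Phi> \<psi> ` \<Omega>)}"

definition Lp :: "(real ^ 'n) measure \<Rightarrow> (real ^ 'n) set \<Rightarrow> real \<Rightarrow> (real ^ 'n \<Rightarrow> real) set" where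
  "Lp \<mu> \<Omega> p = {f. set_borel_measurable \<mu> \<Omega> f \<and> set_integrable \<mu> \<Omega> (\<lambda>x. \<bar>f x\<bar> powr p)}"

definition T_max_rel ::
  "(real ^ 'n) measure \<Rightarrow> (real ^ 'n) set \<Rightarrow> (real ^ 'n \<Rightarrow> real \<Rightarrow> real ^ 'n) \<Rightarrow> real
     \<Rightarrow> (real ^ 'n \<Rightarrow> real) \<Rightarrow> (real ^ 'n \<Rightarrow> real) \<Rightarrow> bool" where
  "T_max_rel \<mu> \<Omega> \<Phi> p f g \<longleftrightarrow>
     f \<in> Lp \<mu> \<Omega> p \<and> g \<in> Lp \<mu> \<Omega> p \<and>
     (\<forall>\<psi>\<in>test_functions \<mu> \<Omega> \<Phi>.
        (LINT x:\<Omega>|\<mu>. g x * \<psi> x) = (LINT x:\<Omega>|\<mu>. f x * flow_deriv \<Phi> \<psi> x))"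

definition T_max_domain ::
  "(real ^ 'n) measure \<Rightarrow> (real ^ 'n) set \<Rightarrow> (real ^ 'n \<Rightarrow> real \<Rightarrow> real ^ 'n) \<Rightarrow> real
     \<Rightarrow> (real ^ 'n \<Rightarrow> real) set" where
  "T_max_domain \<mu> \<Omega> \<Phi> p = {f. \<exists>g. T_max_rel \<mu> \<Omega> \<Phi> p f g}"

(* Elements of L^p are represented by functions rather than by classes modulo null sets, so the image
   is a chosen representative, determined up to a null set; it should only be compared almost
   everywhere. *)
definition T_max ::
  "(real ^ 'n) measure \<Rightarrow> (real ^ 'n) set \<Rightarrow> (real ^ 'n \<Rightarrow> real \<Rightarrow> real ^ 'n) \<Rightarrow> real
     \<Rightarrow> (real ^ 'n \<Rightarrow> real) \<Rightarrow> (real ^ 'n \<Rightarrow> real)" where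
  "T_max \<mu> \<Omega> \<Phi> p f = (SOME g. T_max_rel \<mu> \<Omega> \<Phi> p f g)"

end

theory Submission
  imports Defs
begin

text \<open>The operator is minus the derivative along the flow, so the claim is the chain rule
  for \<open>r \<mapsto> \<bar>r\<bar>\<^sup>p\<close> along almost every orbit. Weak derivatives do not see single orbits,
  and the proof therefore passes through a mild formulation. Extend \<open>f\<close> and \<open>g\<close> by zero,
  and let \<open>stays \<Omega> h\<close> be the set of points whose orbit stays in \<open>\<Omega>\<close> for the times
  \<open>[0, h]\<close>. For every \<open>h \<ge> 0\<close> and almost every \<open>x \<in> stays \<Omega> h\<close>, the mild
  formulation says \<open>f (\<Phi> x h) = f x - \<integral>\<^sub>0\<^sup>h g (\<Phi> x s) ds\<close>.

  Weak implies mild (lemma \<open>mild_of_weak\<close>): for a continuous \<open>\<phi>\<close> with compact support in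
  the open set \<open>stays \<Omega> h\<close>, the time integral \<open>\<psi> x = \<integral>\<^sub>0\<^sup>h \<phi> (\<Phi> x (- s)) ds\<close> is an
  admissible test function, and the fundamental theorem of calculus gives its derivative along
  the flow: \<open>\<phi> - \<phi> \<circ> \<Phi>(\<cdot>, - h)\<close>. Invariance of the measure moves the flow from \<open>\<phi>\<close> onto
  \<open>f\<close> and \<open>g\<close>; as \<open>\<phi>\<close> is arbitrary, the mild identity follows from the inner
  regularity of the measure (lemma \<open>zero_AE_if_orthogonal\<close>).

  The mild identity survives composition with \<open>\<bar>\<cdot>\<bar>\<^sup>p\<close> (lemma \<open>mild_abs_powr\<close>): by Fubini,
  along almost every orbit \<open>f\<close> agrees almost everywhere in time with an indefinite integral, to
  which a one-dimensional chain rule applies (lemma \<open>chain_rule_abs_powr\<close>). That rule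
  is obtained from the \<open>C\<^sup>1\<close> functions \<open>(r\<^sup>2 + \<delta>)\<^bsup>p/2\<^esup>\<close>, whose derivatives vanish at \<open>0\<close>. This
  yields the value \<open>sgn 0 = 0\<close> also for \<open>p = 1\<close>, where \<open>\<bar>\<cdot>\<bar>\<close> is not differentiable.

  Mild implies weak (lemma \<open>weak_of_mild\<close>): difference quotients of a test function along
  the flow are moved onto \<open>f\<close> by invariance, the mild identity turns them into time averages
  of the test function against \<open>g\<close>, and both sides converge as the time step tends to \<open>0\<close>.

  Finally the weak derivative is unique almost everywhere, because the averages
  \<open>\<psi> / h\<close> of the above test functions converge to \<open>\<phi>\<close>. So the chosen representative of
  the operator agrees with the one that was computed.\<close>

section \<open>Elementary inequalities and limits\<close>

lemma abs_le_one_plus_powr: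
  fixes p r :: real
  assumes "1 \<le> p"
  shows "\<bar>r\<bar> \<le> 1 + \<bar>r\<bar> powr p"
proof (cases "\<bar>r\<bar> \<le> 1")
  case False
  then show ?thesis using powr_mono[OF assms, of "\<bar>r\<bar>"] by simp
qed (simp add: add_increasing2)

text \<open>A crude substitute for Young's inequality: the \<open>p\<close>-th power of the larger of \<open>a\<close> and \<open>b\<close> is
  already an upper bound.\<close>

lemma powr_mult_le_sum_powr:
  fixes a b p :: real
  assumes "1 \<le> p" "0 < a" "0 \<le> b"
  shows "a powr (p - 1) * b \<le> a powr p + b powr p"
proof (cases "b \<le> a")
  case True
  then have "a powr (p - 1) * b \<le> a powr (p - 1) * a" by (intro mult_left_mono) auto
  also have "\<dots> = a powr p" using assms by (simp add: powr_diff)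
  finally show ?thesis by (simp add: add_increasing2)
next
  case False
  then have "a powr (p - 1) * b \<le> b powr (p - 1) * b"
    using assms by (intro mult_right_mono powr_mono2) auto
  also have "\<dots> = b powr p" using assms False by (simp add: powr_diff)
  finally show ?thesis by (simp add: add_increasing)
qed

lemma tendsto_difference_quotient:
  fixes q :: "real \<Rightarrow> real"
  assumes "(q has_real_derivative D) (at 0 within S)" "\<And>n. h n \<in> S - {0}" "h \<longlonglongrightarrow> 0"
  shows "(\<lambda>n. (q (h n) - q 0) / h n) \<longlonglongrightarrow> D"
proof -
  have "((\<lambda>k. (q k - q 0) / k) \<longlongrightarrow> D) (at 0 within S)"
    using assms(1) by (simp add: has_field_derivative_iff)
  moreover have "filterlim h (at 0 within S) sequentially"
    using assms(2,3) by (auto simp: filterlim_at)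
  ultimately show ?thesis
    by (rule filterlim_compose)
qed

lemma tendsto_average:
  fixes q :: "real \<Rightarrow> real"
  assumes "continuous_on {0..1} q" "\<And>n. 0 < h n" "\<And>n. h n \<le> 1" "h \<longlonglongrightarrow> 0"
  shows "(\<lambda>n. (LBINT s:{0..h n}. q s) / h n) \<longlonglongrightarrow> q 0"
proof -
  have "((\<lambda>t. integral {0..t} q) has_real_derivative q 0) (at 0 within {0..1})"
    using integral_has_real_derivative[OF assms(1)] by simp
  from tendsto_difference_quotient[OF this, where h = h]
  have "(\<lambda>n. integral {0..h n} q / h n) \<longlonglongrightarrow> q 0"
    using assms by (simp add: less_imp_le less_imp_neq[symmetric])
  moreover have "(LBINT s:{0..h n}. q s) = integral {0..h n} q" for n
    using assms(1) assms(3)[of n]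
    by (intro set_borel_integral_eq_integral borel_integrable_atLeastAtMost') (auto intro: continuous_on_subset)
  ultimately show ?thesis by simp
qed

definition unit_fraction :: "nat \<Rightarrow> real" where "unit_fraction n = 1 / (real n + 1)"

lemma unit_fraction: "0 < unit_fraction n" "unit_fraction n \<le> 1" "unit_fraction \<longlonglongrightarrow> 0"
  using LIMSEQ_Suc[OF lim_1_over_n] by (simp_all add: unit_fraction_def[abs_def] add.commute)

section \<open>The chain rule along an absolutely continuous path\<close>

text \<open>Subdivide \<open>[0, h]\<close> into steps shorter than \<open>\<delta>\<close>; the right-hand sides telescope.\<close>

lemma small_increments_imp_bound:
  fixes H V :: "real \<Rightarrow> real"
  assumes "0 \<le> h" "0 < \<delta>"
    and small: "\<And>s t. 0 \<le> s \<Longrightarrow> s \<le> t \<Longrightarrow> t \<le> h \<Longrightarrow> t - s < \<delta> \<Longrightarrow> \<bar>H t - H s\<bar> \<le> V t - V s"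
  shows "\<bar>H h - H 0\<bar> \<le> V h - V 0"
proof -
  obtain N :: nat where N: "h / \<delta> < real N" using reals_Archimedean2 by blast
  then have N0: "0 < real N" using assms by (smt (verit) divide_nonneg_pos)
  have step: "h / N < \<delta>" using N N0 \<open>0 < \<delta>\<close> by (simp add: field_simps)
  have "k \<le> N \<Longrightarrow> \<bar>H (k * (h / N)) - H 0\<bar> \<le> V (k * (h / N)) - V 0" for k :: nat
  proof (induction k)
    case (Suc k)
    have "real (Suc k) * (h / N) \<le> real N * (h / N)"
      using Suc.prems assms(1) by (intro mult_right_mono) auto
    then have "real (Suc k) * (h / N) \<le> h" using N0 by simp
    moreover have "real (Suc k) * (h / N) - real k * (h / N) = h / N" by (simp add: algebra_simps add_divide_distrib)
    ultimately have "\<bar>H (Suc k * (h / N)) - H (k * (h / N))\<bar> \<le> V (Suc k * (h / N)) - V (k * (h / N))"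
      using assms(1) step by (intro small mult_right_mono) auto
    then show ?case using Suc by linarith
  qed simp
  from this[of N] show ?thesis using N0 by simp
qed

text \<open>The path \<open>w\<close> is only absolutely continuous, so its derivative cannot be used
  pointwise. Instead \<open>H t = \<beta> (w t) - \<integral>\<^sub>0\<^sup>t \<beta>' (w s) u s ds\<close> is shown to be constant: on a short
  interval \<open>\<beta>' \<circ> w\<close> varies by at most \<open>\<epsilon>\<close>, hence \<open>H\<close> changes there by at most \<open>\<epsilon>\<close> times
  the integral of \<open>\<bar>u\<bar>\<close>. These bounds add up to \<open>\<epsilon>\<close> times the integral over \<open>[0, h]\<close>,
  and \<open>\<epsilon>\<close> is arbitrary.\<close>

lemma chain_rule_C1:
  fixes u \<beta> \<beta>' :: "real \<Rightarrow> real" and c h :: real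
  defines "w \<equiv> \<lambda>t. c + integral {0..t} u"
  assumes h: "0 \<le> h" and u: "u absolutely_integrable_on {0..h}"
    and deriv: "\<And>r. (\<beta> has_real_derivative \<beta>' r) (at r)"
    and cont: "continuous_on UNIV \<beta>'"
  shows "(\<lambda>s. \<beta>' (w s) * u s) integrable_on {0..h}"
    and "integral {0..h} (\<lambda>s. \<beta>' (w s) * u s) = \<beta> (w h) - \<beta> c"
proof -
  have u_int: "u integrable_on {0..h}" and abs_int: "(\<lambda>s. \<bar>u s\<bar>) integrable_on {0..h}"
    using u by (auto simp: absolutely_integrable_on_def)
  have w_cont: "continuous_on {0..h} w"
    unfolding w_def using u_int by (intro continuous_intros indefinite_integral_continuous_1)
  have dw_cont: "continuous_on {0..h} (\<lambda>s. \<beta>' (w s))"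
    by (intro continuous_on_compose2[OF cont w_cont]) auto
  define v where "v s = \<beta>' (w s) * u s" for s
  have "v absolutely_integrable_on {0..h}"
    unfolding v_def
  proof (rule absolutely_integrable_bounded_measurable_product_real)
    show "(\<lambda>s. \<beta>' (w s)) \<in> borel_measurable (lebesgue_on {0..h})"
      by (intro continuous_imp_measurable_on_sets_lebesgue dw_cont) auto
    show "bounded ((\<lambda>s. \<beta>' (w s)) ` {0..h})"
      by (intro compact_imp_bounded compact_continuous_image dw_cont) auto
  qed (use u in auto)
  then have v_int: "v integrable_on {0..h}"
    by (simp add: absolutely_integrable_on_def)
  define H where "H t = \<beta> (w t) - integral {0..t} v" for t
  define V where "V t = integral {0..t} (\<lambda>s. \<bar>u s\<bar>)" for t
  have bound: "\<bar>H h - H 0\<bar> \<le> \<epsilon> * V h" if \<epsilon>: "0 < \<epsilon>" for \<epsilon>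
  proof -
    have "uniformly_continuous_on {0..h} (\<lambda>s. \<beta>' (w s))"
      by (intro compact_uniformly_continuous dw_cont) auto
    then obtain \<delta> where \<delta>: "0 < \<delta>"
      "\<And>r s. r \<in> {0..h} \<Longrightarrow> s \<in> {0..h} \<Longrightarrow> \<bar>r - s\<bar> < \<delta> \<Longrightarrow> \<bar>\<beta>' (w r) - \<beta>' (w s)\<bar> < \<epsilon>"
      using \<epsilon> unfolding uniformly_continuous_on_def dist_real_def by metis
    have incr: "\<bar>H t - H s\<bar> \<le> \<epsilon> * V t - \<epsilon> * V s" if st: "0 \<le> s" "s \<le> t" "t \<le> h" "t - s < \<delta>" for s t
    proof -
      have sub: "f integrable_on {a..b}" if "f integrable_on {0..h}" "s \<le> a" "b \<le> t" for f :: "real \<Rightarrow> real" and a b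
        using that st by (intro integrable_on_subinterval[OF that(1)]) auto
      have split: "integral {0..t} f - integral {0..s} f = integral {s..t} f"
        if "f integrable_on {0..h}" for f :: "real \<Rightarrow> real"
        using Henstock_Kurzweil_Integration.integral_combine[of 0 s t f] st integrable_on_subinterval[OF that, of 0 t] by auto
      \<comment> \<open>The mean value theorem for \<open>\<beta>\<close>, followed by the intermediate value theorem for \<open>w\<close>,
        writes the increment of \<open>\<beta> \<circ> w\<close> with the derivative at a point of the path itself.\<close>
      obtain r where r: "r \<in> {s..t}" "\<beta> (w t) - \<beta> (w s) = \<beta>' (w r) * (w t - w s)"
      proof (cases "w s = w t")
        case True
        then show ?thesis using that[of s] st by auto
      next
        case False
        obtain \<xi> where \<xi>: "min (w s) (w t) < \<xi>" "\<xi> < max (w s) (w t)"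
            "\<beta> (max (w s) (w t)) - \<beta> (min (w s) (w t)) = (max (w s) (w t) - min (w s) (w t)) * \<beta>' \<xi>"
          using MVT2[of "min (w s) (w t)" "max (w s) (w t)" \<beta> \<beta>'] deriv False by fastforce
        have wst: "continuous_on {s..t} w"
          using w_cont st by (auto intro: continuous_on_subset)
        have "\<xi> \<in> w ` {s..t}"
        proof (cases "w s \<le> w t")
          case True
          then show ?thesis using IVT'[of w s \<xi> t] \<xi> st wst by (auto simp: min_def max_def)
        next
          case False
          then show ?thesis using IVT2'[of w t \<xi> s] \<xi> st wst by (auto simp: min_def max_def)
        qed
        then obtain r where "r \<in> {s..t}" "\<xi> = w r" by auto
        then show ?thesis
          using that[of r] \<xi>(3) by (cases "w s \<le> w t") (auto simp: min_def max_def algebra_simps)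
      qed
      have "H t - H s = \<beta>' (w r) * integral {s..t} u - integral {s..t} v"
        using r(2) split[OF u_int] split[OF v_int] by (simp add: H_def w_def)
      also have "\<dots> = integral {s..t} (\<lambda>\<tau>. \<beta>' (w r) * u \<tau> - v \<tau>)"
        using sub[OF u_int] sub[OF v_int]
        by (subst integral_diff) (auto intro: integrable_on_mult_right)
      finally have "\<bar>H t - H s\<bar> = norm (integral {s..t} (\<lambda>\<tau>. \<beta>' (w r) * u \<tau> - v \<tau>))" by simp
      also have "\<dots> \<le> integral {s..t} (\<lambda>\<tau>. \<epsilon> * \<bar>u \<tau>\<bar>)"
      proof (rule integral_norm_bound_integral)
        fix \<tau> assume \<tau>: "\<tau> \<in> {s..t}"
        then have "\<bar>\<beta>' (w r) - \<beta>' (w \<tau>)\<bar> \<le> \<epsilon>"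
          using r(1) st by (intro less_imp_le \<delta>(2)) auto
        then have "\<bar>\<beta>' (w r) - \<beta>' (w \<tau>)\<bar> * \<bar>u \<tau>\<bar> \<le> \<epsilon> * \<bar>u \<tau>\<bar>"
          by (intro mult_right_mono) auto
        then show "norm (\<beta>' (w r) * u \<tau> - v \<tau>) \<le> \<epsilon> * \<bar>u \<tau>\<bar>"
          by (simp add: v_def left_diff_distrib[symmetric] abs_mult)
      qed (use sub[OF u_int] sub[OF v_int] sub[OF abs_int] in
            \<open>auto intro!: integrable_diff integrable_on_mult_right\<close>)
      also have "\<dots> = \<epsilon> * V t - \<epsilon> * V s"
        using split[OF abs_int] by (simp add: V_def right_diff_distrib[symmetric])
      finally show ?thesis .
    qed
    show ?thesis
      using small_increments_imp_bound[where V = "\<lambda>t. \<epsilon> * V t", OF h \<delta>(1) incr] by (simp add: V_def)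
  qed
  have "H h - H 0 = 0"
  proof (rule ccontr)
    assume "H h - H 0 \<noteq> 0"
    moreover have V: "0 \<le> V h" unfolding V_def using abs_int by (intro integral_nonneg) auto
    ultimately have pos: "0 < \<bar>H h - H 0\<bar>" "0 < V h + 1" by auto
    then have "\<bar>H h - H 0\<bar> \<le> \<bar>H h - H 0\<bar> / (2 * (V h + 1)) * V h"
      by (intro bound) auto
    also have "\<dots> = \<bar>H h - H 0\<bar> * (V h / (2 * (V h + 1)))" by simp
    also have "\<dots> < \<bar>H h - H 0\<bar> * 1"
      using pos V by (intro mult_strict_left_mono) auto
    finally show False by simp
  qed
  then show "integral {0..h} (\<lambda>s. \<beta>' (w s) * u s) = \<beta> (w h) - \<beta> c"
    by (simp add: H_def v_def[abs_def] w_def)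
  show "(\<lambda>s. \<beta>' (w s) * u s) integrable_on {0..h}"
    using v_int by (simp add: v_def[abs_def])
qed

text \<open>The function \<open>\<bar>\<cdot>\<bar>\<^sup>p\<close> is the limit of the \<open>C\<^sup>1\<close> functions \<open>(r\<^sup>2 + \<delta>)\<^bsup>p/2\<^esup>\<close>. Their derivatives
  vanish at \<open>0\<close>, converge pointwise to \<open>p sgn r \<bar>r\<bar>\<^bsup>p-1\<^esup>\<close>, and are uniformly bounded on the compact
  range of \<open>w\<close>, so dominated convergence applies.\<close>

lemma chain_rule_abs_powr:
  fixes u :: "real \<Rightarrow> real" and c h p :: real
  defines "w \<equiv> \<lambda>t. c + integral {0..t} u"
  assumes h: "0 \<le> h" and p: "1 \<le> p" and u: "u absolutely_integrable_on {0..h}"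
  shows "integral {0..h} (\<lambda>s. p * sgn (w s) * \<bar>w s\<bar> powr (p - 1) * u s) = \<bar>w h\<bar> powr p - \<bar>c\<bar> powr p"
proof -
  define \<delta> where "\<delta> n = 1 / (real n + 1)" for n
  have \<delta>: "0 < \<delta> n" "\<delta> n \<le> 1" for n by (auto simp: \<delta>_def)
  have \<delta>0: "\<delta> \<longlonglongrightarrow> 0"
    using LIMSEQ_Suc[OF lim_1_over_n] by (simp add: \<delta>_def[abs_def] add.commute)
  define \<beta> where "\<beta> n r = (r\<^sup>2 + \<delta> n) powr (p / 2)" for n and r :: real
  define \<beta>' where "\<beta>' n r = p * r * (r\<^sup>2 + \<delta> n) powr (p / 2 - 1)" for n and r :: real
  have pos: "0 < r\<^sup>2 + \<delta> n" for r n using \<delta>[of n] by (simp add: add_nonneg_pos)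
  have deriv: "(\<beta> n has_real_derivative \<beta>' n r) (at r)" for n r
    unfolding \<beta>_def \<beta>'_def using pos[of r n]
    by (auto intro!: derivative_eq_intros simp: powr_diff simp del: distrib_left_numeral)
  have cont: "continuous_on UNIV (\<beta>' n)" for n
    unfolding \<beta>'_def using pos[of _ n]
    by (intro continuous_intros) (auto simp: less_imp_neq[symmetric])
  have chain: "(\<lambda>s. \<beta>' n (w s) * u s) integrable_on {0..h}"
    "integral {0..h} (\<lambda>s. \<beta>' n (w s) * u s) = \<beta> n (w h) - \<beta> n c" for n
    unfolding w_def by (rule chain_rule_C1[OF h u deriv cont])+
  have \<beta>_lim: "(\<lambda>n. \<beta> n r) \<longlonglongrightarrow> \<bar>r\<bar> powr p" for r
  proof -
    have "(\<lambda>n. (r\<^sup>2 + \<delta> n) powr (p / 2)) \<longlonglongrightarrow> (r\<^sup>2 + 0) powr (p / 2)"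
      using p pos by (intro tendsto_powr2 tendsto_intros \<delta>0) (auto intro!: always_eventually less_imp_le)
    moreover have "(r\<^sup>2) powr (p / 2) = \<bar>r\<bar> powr p"
      using powr_powr[of "\<bar>r\<bar>" 2 "p / 2"] by (cases "r = 0") (auto simp: powr_numeral)
    ultimately show ?thesis by (simp add: \<beta>_def)
  qed
  have \<beta>'_lim: "(\<lambda>n. \<beta>' n r) \<longlonglongrightarrow> p * sgn r * \<bar>r\<bar> powr (p - 1)" for r
  proof (cases "r = 0")
    case True
    then show ?thesis by (simp add: \<beta>'_def)
  next
    case False
    then have "(\<lambda>n. p * r * (r\<^sup>2 + \<delta> n) powr (p / 2 - 1)) \<longlonglongrightarrow> p * r * (r\<^sup>2 + 0) powr (p / 2 - 1)"
      by (intro tendsto_intros \<delta>0) auto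
    moreover have "r * (r\<^sup>2) powr (p / 2 - 1) = sgn r * \<bar>r\<bar> powr (p - 1)"
    proof -
      have "(r\<^sup>2) powr (p / 2 - 1) = \<bar>r\<bar> powr (p - 2)"
        using powr_powr[of "\<bar>r\<bar>" 2 "p / 2 - 1"] False by (simp add: powr_numeral algebra_simps)
      also have "\<dots> = \<bar>r\<bar> powr (p - 1) / \<bar>r\<bar>"
        using False powr_diff[of "\<bar>r\<bar>" "p - 1" 1] by simp
      finally show ?thesis using False by (simp add: sgn_if)
    qed
    ultimately show ?thesis by (simp add: \<beta>'_def mult.assoc)
  qed
  have u_int: "u integrable_on {0..h}" and abs_int: "(\<lambda>s. \<bar>u s\<bar>) integrable_on {0..h}"
    using u by (auto simp: absolutely_integrable_on_def)
  have "continuous_on {0..h} w"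
    unfolding w_def using u_int by (intro continuous_intros indefinite_integral_continuous_1)
  then have "bounded (w ` {0..h})"
    by (intro compact_imp_bounded compact_continuous_image) auto
  then obtain R where R: "\<And>s. s \<in> {0..h} \<Longrightarrow> \<bar>w s\<bar> \<le> R"
    by (fastforce simp: bounded_iff)
  have bound: "\<bar>\<beta>' n r\<bar> \<le> p * (R\<^sup>2 + 1) powr ((p - 1) / 2)" if "\<bar>r\<bar> \<le> R" for n r
  proof -
    \<comment> \<open>The factor \<open>r\<close> absorbs half a power, which makes the exponent \<open>(p - 1) / 2\<close> nonnegative.\<close>
    have "\<bar>r\<bar> \<le> sqrt (r\<^sup>2 + \<delta> n)"
      using \<delta>[of n] by (intro real_le_rsqrt) auto
    then have "\<bar>r\<bar> * (r\<^sup>2 + \<delta> n) powr (p / 2 - 1) \<le> (r\<^sup>2 + \<delta> n) powr (1 / 2) * (r\<^sup>2 + \<delta> n) powr (p / 2 - 1)"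
      using pos[of r n] by (intro mult_right_mono) (auto simp: powr_half_sqrt)
    also have "\<dots> = (r\<^sup>2 + \<delta> n) powr ((p - 1) / 2)"
      by (simp add: powr_add[symmetric] field_simps)
    also have "\<dots> \<le> (R\<^sup>2 + 1) powr ((p - 1) / 2)"
    proof (rule powr_mono2)
      have "r\<^sup>2 \<le> R\<^sup>2" using power_mono[OF that, of 2] by simp
      then show "r\<^sup>2 + \<delta> n \<le> R\<^sup>2 + 1" using \<delta>[of n] by linarith
    qed (use p pos[of r n] in auto)
    finally show ?thesis
      using p pos[of r n] by (simp add: \<beta>'_def abs_mult mult.assoc)
  qed
  have "(\<lambda>n. integral {0..h} (\<lambda>s. \<beta>' n (w s) * u s)) \<longlonglongrightarrow>
      integral {0..h} (\<lambda>s. p * sgn (w s) * \<bar>w s\<bar> powr (p - 1) * u s)"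
  proof (rule dominated_convergence(2))
    show "(\<lambda>s. p * (R\<^sup>2 + 1) powr ((p - 1) / 2) * \<bar>u s\<bar>) integrable_on {0..h}"
      using abs_int by (rule integrable_on_mult_right)
    show "norm (\<beta>' n (w s) * u s) \<le> p * (R\<^sup>2 + 1) powr ((p - 1) / 2) * \<bar>u s\<bar>" if "s \<in> {0..h}" for n s
      using bound[OF R[OF that], of n] by (auto simp: abs_mult intro!: mult_right_mono)
    show "(\<lambda>n. \<beta>' n (w s) * u s) \<longlonglongrightarrow> p * sgn (w s) * \<bar>w s\<bar> powr (p - 1) * u s" for s
      by (intro tendsto_mult \<beta>'_lim tendsto_const)
  qed (rule chain(1))
  moreover have "(\<lambda>n. integral {0..h} (\<lambda>s. \<beta>' n (w s) * u s)) \<longlonglongrightarrow> \<bar>w h\<bar> powr p - \<bar>c\<bar> powr p"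
    unfolding chain(2) by (intro tendsto_diff \<beta>_lim)
  ultimately show ?thesis
    by (rule LIMSEQ_unique)
qed

section \<open>The flow of a Lipschitz vector field\<close>

text \<open>Gronwall's inequality in its simplest form: for the difference \<open>d\<close> of two solutions,
  \<open>\<bar>d\<bar>\<^sup>2 exp (- 2 L t)\<close> is nonincreasing in \<open>t \<ge> 0\<close> and \<open>\<bar>d\<bar>\<^sup>2 exp (2 L t)\<close> is nondecreasing in
  \<open>t \<le> 0\<close>.\<close>

lemma flow_of_lipschitz_dependence:
  fixes F :: "real ^ 'n \<Rightarrow> real ^ 'n"
  assumes F: "L-lipschitz_on UNIV F" and flow: "flow_of F \<Phi>"
  shows "norm (\<Phi> x t - \<Phi> y t) \<le> exp (L * \<bar>t\<bar>) * norm (x - y)"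
proof -
  have L: "0 \<le> L" using F by (rule lipschitz_on_nonneg)
  define d where "d s = \<Phi> x s - \<Phi> y s" for s
  define d' where "d' s = F (\<Phi> x s) - F (\<Phi> y s)" for s
  have d: "(d has_vector_derivative d' s) (at s)" for s
    unfolding d_def d'_def using flow by (intro has_vector_derivative_diff) (auto simp: flow_of_def solves_ivp_def)
  have n: "((\<lambda>s. d s \<bullet> d s) has_real_derivative 2 * (d s \<bullet> d' s)) (at s)" for s
  proof -
    have "((\<lambda>s. d s \<bullet> d s) has_derivative (\<lambda>k. d s \<bullet> (k *\<^sub>R d' s) + (k *\<^sub>R d' s) \<bullet> d s)) (at s)"
      using d[of s] unfolding has_vector_derivative_def by (intro has_derivative_inner)
    then show ?thesis
      unfolding has_field_derivative_def
      by (rule has_derivative_eq_rhs) (auto simp: inner_commute algebra_simps)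
  qed
  have dd': "\<bar>d s \<bullet> d' s\<bar> \<le> L * (d s \<bullet> d s)" for s
  proof -
    have "\<bar>d s \<bullet> d' s\<bar> \<le> norm (d s) * norm (d' s)" by (rule Cauchy_Schwarz_ineq2)
    also have "\<dots> \<le> norm (d s) * (L * norm (d s))"
      using lipschitz_onD[OF F, of "\<Phi> x s" "\<Phi> y s"] by (intro mult_left_mono) (auto simp: d_def d'_def dist_norm)
    also have "\<dots> = L * (d s \<bullet> d s)" by (simp add: power2_norm_eq_inner[symmetric] power2_eq_square)
    finally show ?thesis .
  qed
  have "d t \<bullet> d t \<le> exp (2 * L * \<bar>t\<bar>) * (d 0 \<bullet> d 0)"
  proof (cases "0 \<le> t")
    case True
    have "exp (- 2 * L * t) * (d t \<bullet> d t) \<le> exp (- 2 * L * 0) * (d 0 \<bullet> d 0)"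
    proof (rule DERIV_nonpos_imp_nonincreasing[OF True])
      fix s
      have "((\<lambda>s. exp (- 2 * L * s) * (d s \<bullet> d s)) has_real_derivative
          exp (- 2 * L * s) * (2 * (d s \<bullet> d' s) - 2 * L * (d s \<bullet> d s))) (at s)"
        by (auto intro!: derivative_eq_intros n simp: algebra_simps)
      moreover have "exp (- 2 * L * s) * (2 * (d s \<bullet> d' s) - 2 * L * (d s \<bullet> d s)) \<le> 0"
        using dd'[of s] by (intro mult_nonneg_nonpos) auto
      ultimately show "\<exists>y. ((\<lambda>s. exp (- 2 * L * s) * (d s \<bullet> d s)) has_real_derivative y) (at s) \<and> y \<le> 0"
        by blast
    qed
    then have "exp (2 * L * t) * (exp (- 2 * L * t) * (d t \<bullet> d t)) \<le> exp (2 * L * t) * (d 0 \<bullet> d 0)"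
      by (intro mult_left_mono) auto
    then show ?thesis using True by (simp add: mult.assoc[symmetric] exp_add[symmetric])
  next
    case False
    then have t: "t \<le> 0" by simp
    have "exp (2 * L * t) * (d t \<bullet> d t) \<le> exp (2 * L * 0) * (d 0 \<bullet> d 0)"
    proof (rule DERIV_nonneg_imp_nondecreasing[OF t])
      fix s
      have "((\<lambda>s. exp (2 * L * s) * (d s \<bullet> d s)) has_real_derivative
          exp (2 * L * s) * (2 * (d s \<bullet> d' s) + 2 * L * (d s \<bullet> d s))) (at s)"
        by (auto intro!: derivative_eq_intros n simp: algebra_simps)
      moreover have "0 \<le> exp (2 * L * s) * (2 * (d s \<bullet> d' s) + 2 * L * (d s \<bullet> d s))"
        using dd'[of s] by (intro mult_nonneg_nonneg) auto
      ultimately show "\<exists>y. ((\<lambda>s. exp (2 * L * s) * (d s \<bullet> d s)) has_real_derivative y) (at s) \<and> 0 \<le> y"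
        by blast
    qed
    then have "exp (- 2 * L * t) * (exp (2 * L * t) * (d t \<bullet> d t)) \<le> exp (- 2 * L * t) * (d 0 \<bullet> d 0)"
      by (intro mult_left_mono) auto
    then show ?thesis using False by (simp add: mult.assoc[symmetric] exp_add[symmetric])
  qed
  also have "\<dots> = (exp (L * \<bar>t\<bar>) * norm (d 0))\<^sup>2"
    by (simp add: power_mult_distrib power2_norm_eq_inner exp_double[symmetric] mult.assoc)
  finally have "(norm (d t))\<^sup>2 \<le> (exp (L * \<bar>t\<bar>) * norm (d 0))\<^sup>2"
    by (simp add: power2_norm_eq_inner)
  then have "norm (d t) \<le> exp (L * \<bar>t\<bar>) * norm (d 0)"
    by (rule power2_le_imp_le) simp
  then show ?thesis
    using flow by (simp add: d_def flow_of_def solves_ivp_def)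
qed

lemma flow_of_jointly_continuous:
  fixes F :: "real ^ 'n \<Rightarrow> real ^ 'n"
  assumes F: "L-lipschitz_on UNIV F" and flow: "flow_of F \<Phi>"
  shows "continuous_on UNIV (\<lambda>z. \<Phi> (fst z) (snd z))"
  unfolding continuous_on_def
proof
  fix z :: "(real ^ 'n) \<times> real"
  obtain x t where z: "z = (x, t)" by (cases z)
  have cont: "isCont (\<Phi> x) t"
    using flow by (auto simp: flow_of_def solves_ivp_def intro: has_vector_derivative_continuous)
  have "((\<lambda>y. exp (L * \<bar>snd y\<bar>) * norm (fst y - x) + norm (\<Phi> x (snd y) - \<Phi> x t)) \<longlongrightarrow>
      exp (L * \<bar>t\<bar>) * norm (x - x) + norm (\<Phi> x t - \<Phi> x t)) (at z)"
    by (intro tendsto_intros isCont_tendsto_compose[OF cont])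
       (auto simp: z intro!: tendsto_eq_intros)
  then have lim: "((\<lambda>y. exp (L * \<bar>snd y\<bar>) * norm (fst y - x) + norm (\<Phi> x (snd y) - \<Phi> x t)) \<longlongrightarrow> 0) (at z)"
    by simp
  have "((\<lambda>y. \<Phi> (fst y) (snd y) - \<Phi> x t) \<longlongrightarrow> 0) (at z)"
  proof (rule Lim_null_comparison[OF always_eventually lim], rule allI)
    fix y :: "(real ^ 'n) \<times> real"
    show "norm (\<Phi> (fst y) (snd y) - \<Phi> x t) \<le>
        exp (L * \<bar>snd y\<bar>) * norm (fst y - x) + norm (\<Phi> x (snd y) - \<Phi> x t)"
      using norm_triangle_ineq[of "\<Phi> (fst y) (snd y) - \<Phi> x (snd y)" "\<Phi> x (snd y) - \<Phi> x t"]
        flow_of_lipschitz_dependence[OF F flow, of "fst y" "snd y" x] by simp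
  qed
  then show "((\<lambda>z. \<Phi> (fst z) (snd z)) \<longlongrightarrow> \<Phi> (fst z) (snd z)) (at z within UNIV)"
    by (simp add: z LIM_zero_iff)
qed

text \<open>A time-shifted solution solves the autonomous equation, so uniqueness applies.\<close>

lemma flow_of_group:
  fixes F :: "real ^ 'n \<Rightarrow> real ^ 'n"
  assumes "flow_of F \<Phi>"
  shows "\<Phi> (\<Phi> x s) t = \<Phi> x (s + t)"
proof -
  have "solves_ivp F (\<Phi> x s) (\<lambda>t. \<Phi> x (s + t))"
    unfolding solves_ivp_def
  proof (intro conjI allI)
    fix t
    have "(\<Phi> x has_vector_derivative F (\<Phi> x (s + t))) (at (s + t))"
      using assms by (simp add: flow_of_def solves_ivp_def)
    moreover have "((\<lambda>t. s + t) has_vector_derivative 1) (at t)"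
      by (auto intro!: derivative_eq_intros)
    ultimately show "((\<lambda>t. \<Phi> x (s + t)) has_vector_derivative F (\<Phi> x (s + t))) (at t)"
      using vector_diff_chain_at[of "\<lambda>t. s + t" 1 t "\<Phi> x"] by (simp add: o_def)
  qed simp
  then show ?thesis
    using assms unfolding flow_of_def by metis
qed

section \<open>Flows that preserve a Radon measure\<close>

text \<open>All that is used of the differential equation: a continuous action of the real line that preserves
  a Radon measure.\<close>

locale invariant_flow =
  fixes \<mu> :: "(real ^ 'n) measure" and \<Phi> :: "real ^ 'n \<Rightarrow> real \<Rightarrow> real ^ 'n"
  assumes radon: "radon_measure \<mu>"
    and flow_zero [simp]: "\<Phi> x 0 = x"
    and flow_add [simp]: "\<Phi> (\<Phi> x s) t = \<Phi> x (s + t)"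
    and flow_cont: "continuous_on UNIV (\<lambda>z. \<Phi> (fst z) (snd z))"
    and flow_inv: "flow_invariant \<mu> \<Phi>"
begin

lemma sets_mu [measurable_cong]: "sets \<mu> = sets borel"
  using radon by (simp add: radon_measure_def)

lemma space_mu [simp]: "space \<mu> = UNIV"
  using sets_eq_imp_space_eq[OF sets_mu] by simp

lemma emeasure_compact_finite: "compact K \<Longrightarrow> emeasure \<mu> K < \<infinity>"
  using radon by (simp add: radon_measure_def)

lemma integrable_const_on_compact: "compact K \<Longrightarrow> integrable \<mu> (\<lambda>x. indicator K x * (c :: real))"
  using emeasure_compact_finite by (auto simp: sets_mu intro!: integrable_mult_left
    simp: integrable_indicator_iff compact_imp_closed borel_closed)

lemma sigma_finite_mu: "sigma_finite_measure \<mu>"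
proof
  show "\<exists>A. countable A \<and> A \<subseteq> sets \<mu> \<and> \<Union>A = space \<mu> \<and> (\<forall>a\<in>A. emeasure \<mu> a \<noteq> \<infinity>)"
  proof (intro exI[of _ "range (\<lambda>n::nat. cball 0 (real n))"] conjI)
    show "\<Union> (range (\<lambda>n::nat. cball (0::real^'n) (real n))) = space \<mu>"
      using real_arch_simple by (auto simp: dist_norm)
    show "\<forall>a\<in>range (\<lambda>n::nat. cball 0 (real n)). emeasure \<mu> a \<noteq> \<infinity>"
      using emeasure_compact_finite[OF compact_cball] by (auto simp: less_top)
  qed (auto simp: sets_mu)
qed

sublocale sigma_finite_measure \<mu>
  by (rule sigma_finite_mu)

sublocale space_time: pair_sigma_finite \<mu> lborel ..

sublocale time_space: pair_sigma_finite lborel \<mu> ..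

lemma continuous_on_flow [continuous_intros]:
  assumes "continuous_on S a" "continuous_on S b"
  shows "continuous_on S (\<lambda>z. \<Phi> (a z) (b z))"
  using continuous_on_compose2[OF flow_cont continuous_on_Pair[OF assms]] by simp

lemma measurable_flow [measurable]:
  assumes "a \<in> borel_measurable M" "b \<in> borel_measurable M"
  shows "(\<lambda>z. \<Phi> (a z) (b z)) \<in> borel_measurable M"
  using assms flow_cont by (rule borel_measurable_continuous_Pair)

lemma vimage_flow: "(\<lambda>x. \<Phi> x t) -` A = (\<lambda>x. \<Phi> x (- t)) ` A"
proof (intro equalityI subsetI)
  fix x assume "x \<in> (\<lambda>x. \<Phi> x t) -` A"
  then show "x \<in> (\<lambda>x. \<Phi> x (- t)) ` A"
    by (intro image_eqI[of _ _ "\<Phi> x t"]) auto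
qed auto

lemma distr_flow: "distr \<mu> \<mu> (\<lambda>x. \<Phi> x t) = \<mu>"
proof (rule measure_eqI)
  have [measurable]: "(\<lambda>x. \<Phi> x t) \<in> measurable \<mu> \<mu>"
    by (simp cong: measurable_cong_sets add: measurable_cong_sets[OF refl sets_mu])
  fix A assume A: "A \<in> sets (distr \<mu> \<mu> (\<lambda>x. \<Phi> x t))"
  then have "emeasure (distr \<mu> \<mu> (\<lambda>x. \<Phi> x t)) A = emeasure \<mu> ((\<lambda>x. \<Phi> x (- t)) ` A)"
    by (subst emeasure_distr) (auto simp: vimage_flow)
  also have "\<dots> = emeasure \<mu> A"
    using flow_inv A by (auto simp: flow_invariant_def)
  finally show "emeasure (distr \<mu> \<mu> (\<lambda>x. \<Phi> x t)) A = emeasure \<mu> A" .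
qed simp

lemma integrable_flow:
  fixes u :: "real ^ 'n \<Rightarrow> real"
  assumes "integrable \<mu> u"
  shows "integrable \<mu> (\<lambda>x. u (\<Phi> x t))"
proof -
  have m: "(\<lambda>x. \<Phi> x t) \<in> measurable \<mu> \<mu>"
    by (simp add: measurable_cong_sets[OF refl sets_mu])
  show ?thesis
    using integrable_distr[OF m, of u] assms by (simp add: distr_flow)
qed

lemma integral_flow:
  fixes u :: "real ^ 'n \<Rightarrow> real"
  assumes [measurable]: "u \<in> borel_measurable borel"
  shows "(\<integral>x. u (\<Phi> x t) \<partial>\<mu>) = (\<integral>x. u x \<partial>\<mu>)"
proof -
  have m: "(\<lambda>x. \<Phi> x t) \<in> measurable \<mu> \<mu>"
    by (simp add: measurable_cong_sets[OF refl sets_mu])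
  show ?thesis
    using integral_distr[OF m, of u] by (simp add: distr_flow)
qed

text \<open>Tonelli's criterion: by invariance, the inner integral over space is bounded uniformly in time.\<close>

lemma integrable_flow_product:
  fixes u \<phi> :: "real ^ 'n \<Rightarrow> real"
  assumes u: "integrable \<mu> u"
    and [measurable]: "\<phi> \<in> borel_measurable borel"
    and bounded: "\<And>x. \<bar>\<phi> x\<bar> \<le> B"
  shows "integrable (lborel \<Otimes>\<^sub>M \<mu>) (\<lambda>(s, x). indicator {0..h} s * (u (\<Phi> x s) * \<phi> x))"
proof (rule time_space.Fubini_integrable)
  have [measurable]: "u \<in> borel_measurable borel"
    using borel_measurable_integrable[OF u] by (simp add: measurable_cong_sets[OF sets_mu refl])
  show [measurable]: "(\<lambda>(s, x). indicator {0..h} s * (u (\<Phi> x s) * \<phi> x)) \<in> borel_measurable (lborel \<Otimes>\<^sub>M \<mu>)"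
    by measurable
  have B: "0 \<le> B" using bounded[of 0] by linarith
  have int1: "integrable \<mu> (\<lambda>x. u (\<Phi> x s) * \<phi> x)" for s
    by (rule Bochner_Integration.integrable_bound[OF integrable_mult_left[of B, OF integrable_flow[OF u, of s]]])
       (auto simp: abs_mult intro!: mult_left_mono order_trans[OF bounded])
  then show "AE s in lborel. integrable \<mu> (\<lambda>x. case (s, x) of (s, x) \<Rightarrow> indicator {0..h} s * (u (\<Phi> x s) * \<phi> x))"
    by simp
  show "integrable lborel (\<lambda>s. \<integral>x. norm (case (s, x) of (s, x) \<Rightarrow> indicator {0..h} s * (u (\<Phi> x s) * \<phi> x)) \<partial>\<mu>)"
  proof (rule Bochner_Integration.integrable_bound)
    show "integrable lborel (\<lambda>s. indicator {0..h} s * (B * (\<integral>x. \<bar>u x\<bar> \<partial>\<mu>)))"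
      by (intro integrable_mult_left integrable_real_indicator emeasure_bounded_finite) auto
    show "AE s in lborel. norm (\<integral>x. norm (case (s, x) of (s, x) \<Rightarrow> indicator {0..h} s * (u (\<Phi> x s) * \<phi> x)) \<partial>\<mu>)
        \<le> norm (indicator {0..h} s * (B * (\<integral>x. \<bar>u x\<bar> \<partial>\<mu>)))"
    proof (rule AE_I2)
      fix s :: real
      have "(\<integral>x. \<bar>u (\<Phi> x s)\<bar> * \<bar>\<phi> x\<bar> \<partial>\<mu>) \<le> (\<integral>x. \<bar>u (\<Phi> x s)\<bar> * B \<partial>\<mu>)"
        using int1[of s] integrable_flow[OF u, of s] bounded
        by (intro integral_mono mult_left_mono)
           (auto dest: integrable_abs simp: abs_mult)
      also have "\<dots> = B * (\<integral>x. \<bar>u x\<bar> \<partial>\<mu>)"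
        using integral_flow[of "\<lambda>x. \<bar>u x\<bar>" s] by simp
      finally have *: "(\<integral>x. \<bar>u (\<Phi> x s)\<bar> * \<bar>\<phi> x\<bar> \<partial>\<mu>) \<le> B * (\<integral>x. \<bar>u x\<bar> \<partial>\<mu>)" .
      then show "norm (\<integral>x. norm (case (s, x) of (s, x) \<Rightarrow> indicator {0..h} s * (u (\<Phi> x s) * \<phi> x)) \<partial>\<mu>)
        \<le> norm (indicator {0..h} s * (B * (\<integral>x. \<bar>u x\<bar> \<partial>\<mu>)))"
        using B by (auto simp: abs_mult split: split_indicator)
    qed
  qed measurable
qed

text \<open>Integration forwards along the flow is adjoint to integration backwards: apply Fubini and substitute
  \<open>x \<mapsto> \<Phi> x (- s)\<close> at each fixed time.\<close>

lemma flow_duality: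
  fixes u \<phi> :: "real ^ 'n \<Rightarrow> real"
  assumes u: "integrable \<mu> u"
    and [measurable]: "\<phi> \<in> borel_measurable borel"
    and bounded: "\<And>x. \<bar>\<phi> x\<bar> \<le> B"
  shows "(\<integral>x. \<phi> x * (LBINT s:{0..h}. u (\<Phi> x s)) \<partial>\<mu>) = (\<integral>x. u x * (LBINT s:{0..h}. \<phi> (\<Phi> x (- s))) \<partial>\<mu>)"
    and "integrable \<mu> (\<lambda>x. \<phi> x * (LBINT s:{0..h}. u (\<Phi> x s)))"
proof -
  have um [measurable]: "u \<in> borel_measurable borel"
    using borel_measurable_integrable[OF u] by (simp add: measurable_cong_sets[OF sets_mu refl])
  have B: "0 \<le> B" using bounded[of 0] by linarith
  note 1 = integrable_flow_product[OF assms, of h]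
  have swapped: "integrable (\<mu> \<Otimes>\<^sub>M lborel) (\<lambda>(x, s). indicator {0..h} s * (u (\<Phi> x s) * \<phi> x))"
    using time_space.integrable_product_swap[OF 1] by (simp add: case_prod_unfold)
  have eq: "\<phi> x * (LBINT s:{0..h}. u (\<Phi> x s)) = (\<integral>s. indicator {0..h} s * (u (\<Phi> x s) * \<phi> x) \<partial>lborel)" for x
    by (simp add: set_lebesgue_integral_def mult.commute[of _ "\<phi> x"] mult.left_commute[of _ "\<phi> x"])
  show "integrable \<mu> (\<lambda>x. \<phi> x * (LBINT s:{0..h}. u (\<Phi> x s)))"
    unfolding eq using space_time.integrable_fst[OF swapped] by simp
  have shift: "(\<integral>x. u (\<Phi> x s) * \<phi> x \<partial>\<mu>) = (\<integral>x. u x * \<phi> (\<Phi> x (- s)) \<partial>\<mu>)" for s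
    using integral_flow[of "\<lambda>x. u x * \<phi> (\<Phi> x (- s))" s] by simp
  have 2: "integrable (lborel \<Otimes>\<^sub>M \<mu>) (\<lambda>(s, x). indicator {0..h} s * (u x * \<phi> (\<Phi> x (- s))))"
  proof (rule Bochner_Integration.integrable_bound)
    have "integrable (lborel \<Otimes>\<^sub>M \<mu>) (\<lambda>(s, x). indicator {0..h} s * (u x * B))"
      by (rule time_space.Fubini_integrable)
         (auto simp: abs_mult intro!: integrable_mult_left integrable_real_indicator u
           emeasure_bounded_finite)
    then show "integrable (lborel \<Otimes>\<^sub>M \<mu>) (\<lambda>(s, x). indicator {0..h} s * (u x * B))" .
    show "AE z in lborel \<Otimes>\<^sub>M \<mu>. norm (case z of (s, x) \<Rightarrow> indicator {0..h} s * (u x * \<phi> (\<Phi> x (- s))))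
        \<le> norm (case z of (s, x) \<Rightarrow> indicator {0..h} s * (u x * B))"
      using B bounded by (intro AE_I2) (auto simp: abs_mult split: split_indicator intro!: mult_left_mono)
  qed measurable
  have "(\<integral>x. \<phi> x * (LBINT s:{0..h}. u (\<Phi> x s)) \<partial>\<mu>) = (\<integral>x. (\<integral>s. indicator {0..h} s * (u (\<Phi> x s) * \<phi> x) \<partial>lborel) \<partial>\<mu>)"
    unfolding eq ..
  also have "\<dots> = (\<integral>s. (\<integral>x. indicator {0..h} s * (u (\<Phi> x s) * \<phi> x) \<partial>\<mu>) \<partial>lborel)"
    using time_space.Fubini_integral[OF 1] .
  also have "\<dots> = (\<integral>s. (\<integral>x. indicator {0..h} s * (u x * \<phi> (\<Phi> x (- s))) \<partial>\<mu>) \<partial>lborel)"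
    by (simp add: shift)
  also have "\<dots> = (\<integral>x. (\<integral>s. indicator {0..h} s * (u x * \<phi> (\<Phi> x (- s))) \<partial>lborel) \<partial>\<mu>)"
    using time_space.Fubini_integral[OF 2] by simp
  also have "\<dots> = (\<integral>x. u x * (LBINT s:{0..h}. \<phi> (\<Phi> x (- s))) \<partial>\<mu>)"
    by (simp add: set_lebesgue_integral_def mult.left_commute[of "indicator _ _" "u _"])
  finally show "(\<integral>x. \<phi> x * (LBINT s:{0..h}. u (\<Phi> x s)) \<partial>\<mu>) = (\<integral>x. u x * (LBINT s:{0..h}. \<phi> (\<Phi> x (- s))) \<partial>\<mu>)" .
qed

lemma AE_orbit_integrable:
  fixes u :: "real ^ 'n \<Rightarrow> real"
  assumes u: "integrable \<mu> u"
  shows "AE x in \<mu>. set_integrable lborel {0..h} (\<lambda>s. u (\<Phi> x s))"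
proof -
  have "integrable (\<mu> \<Otimes>\<^sub>M lborel) (\<lambda>(x, s). indicator {0..h} s * u (\<Phi> x s))"
    using time_space.integrable_product_swap[OF integrable_flow_product[OF u, of "\<lambda>_. 1" 1 h]]
    by (simp add: case_prod_unfold)
  then show ?thesis
    using space_time.AE_integrable_fst by (fastforce simp: set_integrable_def)
qed

section \<open>Orbits that stay in the domain\<close>

definition stays :: "(real ^ 'n) set \<Rightarrow> real \<Rightarrow> (real ^ 'n) set" where
  "stays \<Omega> h = {x. \<forall>s\<in>{0..h}. \<Phi> x s \<in> \<Omega>}"

lemma stays_mono: "h \<le> h' \<Longrightarrow> stays \<Omega> h' \<subseteq> stays \<Omega> h"
  by (auto simp: stays_def)

text \<open>The complement is the projection of a closed set along the compact interval \<open>[0, h]\<close>.\<close>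

lemma open_stays:
  assumes "open \<Omega>"
  shows "open (stays \<Omega> h)"
proof -
  have eq: "- stays \<Omega> h = {x. \<exists>s. s \<in> {0..h} \<and> (s, x) \<in> (\<lambda>z. \<Phi> (snd z) (fst z)) -` (- \<Omega>) \<inter> {0..h} \<times> UNIV}"
    by (auto simp: stays_def)
  have "closed ((\<lambda>z. \<Phi> (snd z) (fst z)) -` (- \<Omega>))"
    using assms by (intro closed_vimage continuous_intros) auto
  then have "closed (- stays \<Omega> h)"
    unfolding eq by (intro closed_compact_projection) (auto intro!: closed_Int closed_Times)
  then show ?thesis
    by (simp add: closed_def)
qed

text \<open>The open sets \<open>stays \<Omega> (1 / (n + 1))\<close> increase with \<open>n\<close> and cover \<open>\<Omega>\<close>.\<close>

lemma compact_subset_stays: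
  assumes "open \<Omega>" "compact K" "K \<subseteq> \<Omega>"
  obtains h where "0 < h" "K \<subseteq> stays \<Omega> h"
proof -
  have cover: "\<exists>n. x \<in> stays \<Omega> (1 / Suc n)" if "x \<in> K" for x
  proof -
    have "open (\<Phi> x -` \<Omega>)"
      using assms(1) continuous_on_flow[OF continuous_on_const continuous_on_id]
      by (intro open_vimage) auto
    moreover have "0 \<in> \<Phi> x -` \<Omega>" using that assms by auto
    ultimately obtain e where e: "0 < e" "ball 0 e \<subseteq> \<Phi> x -` \<Omega>"
      by (meson openE)
    then obtain n where "1 / Suc n < e"
      using nat_approx_posE by (metis)
    then have "x \<in> stays \<Omega> (1 / Suc n)"
      using e(2) by (force simp: stays_def dist_norm)
    then show ?thesis ..
  qed
  obtain I where I: "finite I" "K \<subseteq> (\<Union>n\<in>I. stays \<Omega> (1 / Suc n))"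
    using compactE_image[OF assms(2), of UNIV "\<lambda>n. stays \<Omega> (1 / Suc n)"] cover open_stays[OF assms(1)]
    by (metis (no_types, lifting) UN_iff UNIV_I subsetI)
  have "K \<subseteq> stays \<Omega> (1 / Suc (Max (insert 0 I)))"
  proof
    fix x assume "x \<in> K"
    then obtain n where n: "n \<in> I" "x \<in> stays \<Omega> (1 / Suc n)" using I by auto
    then have "n \<le> Max (insert 0 I)" using I by auto
    then have "1 / real (Suc (Max (insert 0 I))) \<le> 1 / real (Suc n)"
      by (intro divide_left_mono) auto
    then show "x \<in> stays \<Omega> (1 / Suc (Max (insert 0 I)))"
      using stays_mono n by blast
  qed
  then show ?thesis
    using that[of "1 / Suc (Max (insert 0 I))"] by simp
qed

section \<open>Time integrals as test functions\<close>

text \<open>The time runs backwards, so that this operation is adjoint to the forward time integral in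
  the mild formulation.\<close>

definition orbit_integral :: "real \<Rightarrow> (real ^ 'n \<Rightarrow> real) \<Rightarrow> real ^ 'n \<Rightarrow> real" where
  "orbit_integral h \<phi> x = (LBINT s:{0..h}. \<phi> (\<Phi> x (- s)))"

lemma orbit_integral_henstock:
  assumes "continuous_on UNIV \<phi>"
  shows "orbit_integral h \<phi> x = integral {0..h} (\<lambda>s. \<phi> (\<Phi> x (- s)))"
  unfolding orbit_integral_def
  by (rule set_borel_integral_eq_integral, rule borel_integrable_atLeastAtMost')
     (intro continuous_on_compose2[OF assms] continuous_intros, auto)

lemma continuous_orbit_integral:
  assumes "continuous_on UNIV \<phi>"
  shows "continuous_on UNIV (orbit_integral h \<phi>)"
proof -
  have "continuous_on (UNIV \<times> cbox 0 h) (\<lambda>(x, s). \<phi> (\<Phi> x (- s)))"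
    unfolding case_prod_unfold
    by (intro continuous_on_compose2[OF assms] continuous_intros) auto
  from integral_continuous_on_param[OF this] show ?thesis
    by (simp add: orbit_integral_henstock[OF assms] cong: continuous_on_cong)
qed

lemma orbit_integral_bound:
  assumes "continuous_on UNIV \<phi>" "\<And>x. \<bar>\<phi> x\<bar> \<le> B" "0 \<le> h"
  shows "\<bar>orbit_integral h \<phi> x\<bar> \<le> h * B"
proof -
  have "continuous_on {0..h} (\<lambda>s. \<phi> (\<Phi> x (- s)))"
    by (intro continuous_on_compose2[OF assms(1)] continuous_intros) auto
  from integral_bound[OF assms(3) this, of B] assms show ?thesis
    by (simp add: orbit_integral_henstock mult.commute)
qed

text \<open>In terms of an antiderivative \<open>P\<close> of \<open>r \<mapsto> \<phi> (\<Phi> x r)\<close>, the function is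
  \<open>t \<mapsto> P t - P (t - h)\<close>: moving along the orbit only moves the window of integration. This is why
  continuity of \<open>\<phi>\<close> suffices for a \<open>C\<^sup>1\<close> dependence.\<close>

lemma orbit_integral_deriv:
  assumes cont: "continuous_on UNIV \<phi>" and h: "0 \<le> h"
  shows "((\<lambda>t. orbit_integral h \<phi> (\<Phi> x t)) has_vector_derivative \<phi> (\<Phi> x t) - \<phi> (\<Phi> x (t - h))) (at t)"
proof -
  have c: "continuous_on UNIV (\<lambda>r. \<phi> (\<Phi> x r))"
    by (intro continuous_on_compose2[OF cont] continuous_intros) auto
  have "isCont (\<lambda>r. \<phi> (\<Phi> x r)) r" for r
    using c by (simp add: continuous_on_eq_continuous_at)
  then obtain P where P: "\<And>r. (P has_vector_derivative \<phi> (\<Phi> x r)) (at r)"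
    using einterval_antiderivative[of "-\<infinity>" "\<infinity>" "\<lambda>r. \<phi> (\<Phi> x r)"] by auto
  have shift: "((\<lambda>s. P (s + a)) has_vector_derivative \<phi> (\<Phi> x (s + a))) (at s)" for a s
    using P[of "s + a"] by (simp add: has_real_derivative_iff_has_vector_derivative[symmetric] DERIV_shift)
  have "orbit_integral h \<phi> (\<Phi> x t) = P t - P (t - h)" for t
  proof -
    have "((\<lambda>s. - P (t - s)) has_vector_derivative \<phi> (\<Phi> x (t - s))) (at s within {0..h})" for s
      using P[of "t - s"] unfolding has_real_derivative_iff_has_vector_derivative[symmetric]
      by (auto intro!: derivative_eq_intros DERIV_chain2[of P] intro: DERIV_subset)
    from fundamental_theorem_of_calculus[OF h this]
    have "((\<lambda>s. \<phi> (\<Phi> x (t - s))) has_integral P t - P (t - h)) {0..h}"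
      by simp
    then show ?thesis
      by (simp add: orbit_integral_henstock[OF cont] integral_unique)
  qed
  moreover have "((\<lambda>t. P t - P (t - h)) has_vector_derivative \<phi> (\<Phi> x t) - \<phi> (\<Phi> x (t - h))) (at t)"
    using shift[of "- h" t] P by (intro has_vector_derivative_diff) auto
  ultimately show ?thesis by simp
qed

lemma flow_deriv_orbit_integral:
  assumes "continuous_on UNIV \<phi>" "0 \<le> h"
  shows "flow_deriv \<Phi> (orbit_integral h \<phi>) x = \<phi> x - \<phi> (\<Phi> x (- h))"
  using orbit_integral_deriv[OF assms, of x 0]
  by (simp add: flow_deriv_def has_real_derivative_iff_has_vector_derivative[symmetric] DERIV_imp_deriv)

text \<open>The source of test functions. Their supports lie in the set swept out by \<open>S\<close> during
  \<open>[0, h]\<close>, which is compact and contained in \<open>\<Omega>\<close>.\<close>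

lemma orbit_integral_test_function:
  assumes "open \<Omega>" and cont: "continuous_on UNIV \<phi>" and h: "0 \<le> h"
    and bound: "\<And>x. \<bar>\<phi> x\<bar> \<le> B"
    and S: "compact S" "S \<subseteq> stays \<Omega> h" "\<And>x. \<phi> x \<noteq> 0 \<Longrightarrow> x \<in> S"
  shows "orbit_integral h \<phi> \<in> test_functions \<mu> \<Omega> \<Phi>"
proof -
  define K where "K = (\<lambda>z. \<Phi> (fst z) (snd z)) ` (S \<times> {0..h})"
  have K: "compact K" "K \<subseteq> \<Omega>"
    using S by (auto simp: K_def stays_def intro!: compact_continuous_image compact_Times continuous_intros)
  have "x \<in> K" if "orbit_integral h \<phi> x \<noteq> 0" for x
  proof -
    obtain s where s: "s \<in> {0..h}" "\<phi> (\<Phi> x (- s)) \<noteq> 0"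
    proof (rule ccontr)
      assume "\<not> thesis"
      then have "\<And>s. indicator {0..h} s *\<^sub>R \<phi> (\<Phi> x (- s)) = 0"
        using that by (auto split: split_indicator)
      then have "orbit_integral h \<phi> x = 0"
        by (simp add: orbit_integral_def set_lebesgue_integral_def del: scaleR_eq_0_iff real_scaleR_def)
      with \<open>orbit_integral h \<phi> x \<noteq> 0\<close> show False by simp
    qed
    then show "x \<in> K"
      unfolding K_def using S(3) by (intro image_eqI[of _ _ "(\<Phi> x (- s), s)"]) auto
  qed
  then have supp: "closure {x \<in> \<Omega>. orbit_integral h \<phi> x \<noteq> 0} \<subseteq> K"
    using K by (intro closure_minimal) (auto simp: compact_imp_closed)
  have [measurable]: "orbit_integral h \<phi> \<in> borel_measurable borel" "\<phi> \<in> borel_measurable borel"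
    using cont continuous_orbit_integral[OF cont] by (auto intro: borel_measurable_continuous_onI)
  have [measurable]: "\<Omega> \<in> sets borel" using assms(1) by simp
  have fd: "flow_deriv \<Phi> (orbit_integral h \<phi>) = (\<lambda>x. \<phi> x - \<phi> (\<Phi> x (- h)))"
    using flow_deriv_orbit_integral[OF cont h] by auto
  have C1: "(\<lambda>s. orbit_integral h \<phi> (\<Phi> x s)) C1_differentiable_on T" for x T
    unfolding C1_differentiable_on_def
    by (intro exI[of _ "\<lambda>t. \<phi> (\<Phi> x t) - \<phi> (\<Phi> x (t - h))"] conjI ballI orbit_integral_deriv cont h
       continuous_intros continuous_on_compose2[OF cont]) auto
  show ?thesis
    unfolding test_functions_def mem_Collect_eq fd
  proof (intro conjI ballI C1)
    show "set_borel_measurable \<mu> \<Omega> (orbit_integral h \<phi>)"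
      unfolding set_borel_measurable_def by measurable
    show "set_borel_measurable \<mu> \<Omega> (\<lambda>x. \<phi> x - \<phi> (\<Phi> x (- h)))"
      unfolding set_borel_measurable_def by measurable
    show "bounded (orbit_integral h \<phi> ` \<Omega>)"
      using orbit_integral_bound[OF cont bound h] by (auto simp: bounded_iff)
    have "\<bar>\<phi> x - \<phi> (\<Phi> x (- h))\<bar> \<le> 2 * B" for x
      using bound[of x] bound[of "\<Phi> x (- h)"] by linarith
    then show "bounded ((\<lambda>x. \<phi> x - \<phi> (\<Phi> x (- h))) ` \<Omega>)"
      by (auto simp: bounded_iff)
    show "compact (closure {x \<in> \<Omega>. orbit_integral h \<phi> x \<noteq> 0})"
      using supp K by (meson closed_closure compact_Int_closed compact_closure bounded_subset compact_imp_bounded closure_subset subset_trans)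
    show "closure {x \<in> \<Omega>. orbit_integral h \<phi> x \<noteq> 0} \<subseteq> \<Omega>"
      using supp K by blast
  qed
qed

section \<open>Functions orthogonal to all test functions\<close>

text \<open>A variant of the fundamental lemma of the calculus of variations. The indicator of a compact set is
  the limit of continuous functions with supports in a fixed compact neighbourhood, so \<open>u\<close>
  has integral zero over each compact subset of \<open>U\<close>. If \<open>{u > 0}\<close> or \<open>{u < 0}\<close> had positive measure, then
  by inner regularity so would a compact subset, over which the integral of \<open>u\<close> is not zero.\<close>

lemma zero_AE_if_orthogonal:
  fixes u :: "real ^ 'n \<Rightarrow> real"
  assumes U: "open U" and um [measurable]: "u \<in> borel_measurable borel"
    and loc: "\<And>K. compact K \<Longrightarrow> K \<subseteq> U \<Longrightarrow> integrable \<mu> (\<lambda>x. indicator K x * u x)"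
    and orth: "\<And>\<phi> S. continuous_on UNIV \<phi> \<Longrightarrow> (\<And>x. \<bar>\<phi> x\<bar> \<le> 1) \<Longrightarrow> compact S \<Longrightarrow> S \<subseteq> U \<Longrightarrow>
               (\<And>x. \<phi> x \<noteq> 0 \<Longrightarrow> x \<in> S) \<Longrightarrow> (\<integral>x. u x * \<phi> x \<partial>\<mu>) = 0"
  shows "AE x in \<mu>. x \<in> U \<longrightarrow> u x = 0"
proof -
  have compact_zero: "(\<integral>x. indicator C x * u x \<partial>\<mu>) = 0" if C: "compact C" "C \<subseteq> U" for C
  proof (cases "C = {}")
    case False
    obtain e where e: "0 < e" "{x. infdist x C \<le> e} \<subseteq> U"
      using compact_in_open_separated[OF False C(1) U C(2)] by blast
    define S where "S = {x. infdist x C \<le> e}"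
    have S: "compact S" "S \<subseteq> U"
      using e compact_infdist_le[OF False C(1) e(1)] by (auto simp: S_def)
    define \<phi> where "\<phi> n x = max 0 (1 - (real n + 1) * infdist x C / e)" for n x
    have supp: "x \<in> S" if "\<phi> n x \<noteq> 0" for n x
    proof -
      have "(real n + 1) * infdist x C / e < 1"
        using that by (auto simp: \<phi>_def max_def less_le split: if_splits)
      then have "(real n + 1) * infdist x C < e" using e by (simp add: field_simps)
      moreover have "infdist x C \<le> (real n + 1) * infdist x C"
        using infdist_nonneg[of x C] by (simp add: algebra_simps)
      ultimately show ?thesis by (simp add: S_def)
    qed
    have bound: "\<bar>\<phi> n x\<bar> \<le> 1" for n x
      using e infdist_nonneg[of x C] by (auto simp: \<phi>_def max_def)
    have cont: "continuous_on UNIV (\<phi> n)" for n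
      unfolding \<phi>_def using e by (intro continuous_intros) auto
    have [measurable]: "\<phi> n \<in> borel_measurable borel" for n
      using cont by (rule borel_measurable_continuous_onI)
    have [measurable]: "S \<in> sets borel" "C \<in> sets borel"
      using S C by (auto simp: compact_imp_closed borel_closed)
    have "(\<lambda>n. \<integral>x. u x * \<phi> n x \<partial>\<mu>) \<longlonglongrightarrow> (\<integral>x. indicator C x * u x \<partial>\<mu>)"
    proof (rule integral_dominated_convergence)
      have "integrable \<mu> (\<lambda>x. indicator S x * u x)"
        using loc S by simp
      then show "integrable \<mu> (\<lambda>x. \<bar>indicator S x * u x\<bar>)"
        by (rule integrable_abs)
      show "AE x in \<mu>. norm (u x * \<phi> n x) \<le> \<bar>indicator S x * u x\<bar>" for n
      proof (rule AE_I2)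
        fix x
        show "norm (u x * \<phi> n x) \<le> \<bar>indicator S x * u x\<bar>"
          using supp[of n x] bound[of n x] by (cases "\<phi> n x = 0") (auto simp: abs_mult mult_left_le)
      qed
      show "AE x in \<mu>. (\<lambda>n. u x * \<phi> n x) \<longlonglongrightarrow> indicator C x * u x"
      proof (rule AE_I2)
        fix x
        have "(\<lambda>n. \<phi> n x) \<longlonglongrightarrow> indicator C x"
        proof (cases "x \<in> C")
          case True
          then show ?thesis by (simp add: \<phi>_def)
        next
          case xC: False
          then have pos: "0 < infdist x C"
            using C(1) False by (intro infdist_pos_not_in_closed) (auto simp: compact_imp_closed)
          obtain N where N: "e / infdist x C < real N"
            using reals_Archimedean2 by blast
          have "\<phi> n x = 0" if "N \<le> n" for n
          proof -
            have "e / infdist x C < real n + 1" using N that by linarith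
            then show ?thesis using pos e by (simp add: \<phi>_def field_simps max_def)
          qed
          then have "\<forall>\<^sub>F n in sequentially. \<phi> n x = 0"
            using eventually_sequentially by blast
          then show ?thesis
            using xC by (simp add: tendsto_eventually)
        qed
        then have "(\<lambda>n. u x * \<phi> n x) \<longlonglongrightarrow> u x * indicator C x"
          by (intro tendsto_mult tendsto_const)
        then show "(\<lambda>n. u x * \<phi> n x) \<longlonglongrightarrow> indicator C x * u x"
          by (simp add: mult.commute)
      qed
    qed measurable
    moreover have "(\<integral>x. u x * \<phi> n x \<partial>\<mu>) = 0" for n
      using orth[OF cont bound S supp] .
    ultimately show ?thesis
      by (simp add: LIMSEQ_const_iff)
  qed simp
  have null: "{x \<in> U. 0 < c * u x} \<in> null_sets \<mu>" if c: "c = 1 \<or> c = -1" for c :: real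
  proof -
    let ?A = "{x \<in> U. 0 < c * u x}"
    have [measurable]: "U \<in> sets borel" using U by simp
    have A: "?A \<in> sets \<mu>" by measurable
    have "emeasure \<mu> C = 0" if C: "compact C" "C \<subseteq> ?A" for C
    proof -
      have [measurable]: "C \<in> sets borel" using C by (auto simp: compact_imp_closed borel_closed)
      have int: "integrable \<mu> (\<lambda>x. c * (indicator C x * u x))"
        using loc C by (intro integrable_mult_right) auto
      have "AE x in \<mu>. c * (indicator C x * u x) = 0"
      proof (subst integral_nonneg_eq_0_iff_AE[OF int, symmetric])
        show "AE x in \<mu>. 0 \<le> c * (indicator C x * u x)"
          using C(2) by (auto split: split_indicator intro!: AE_I2 less_imp_le)
        show "(\<integral>x. c * (indicator C x * u x) \<partial>\<mu>) = 0"
          using compact_zero C by auto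
      qed
      then have "AE x in \<mu>. x \<notin> C"
        by eventually_elim (use C(2) in \<open>auto split: split_indicator\<close>)
      then show ?thesis
        by (subst (asm) AE_iff_measurable[of C]) (auto simp: sets_mu)
    qed
    then have "(SUP C\<in>{C. compact C \<and> C \<subseteq> ?A}. emeasure \<mu> C) \<le> 0"
      by (intro SUP_least) auto
    moreover have "emeasure \<mu> ?A = (SUP C\<in>{C. compact C \<and> C \<subseteq> ?A}. emeasure \<mu> C)"
      using radon A unfolding radon_measure_def by blast
    ultimately have "emeasure \<mu> ?A = 0" by simp
    then show ?thesis using A by auto
  qed
  have "AE x in \<mu>. x \<notin> {x \<in> U. 0 < 1 * u x}" "AE x in \<mu>. x \<notin> {x \<in> U. 0 < -1 * u x}"
    by (rule AE_not_in[OF null]; simp)+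
  then show ?thesis
    by eventually_elim auto
qed

lemma borel_of_integrable: "integrable \<mu> u \<Longrightarrow> u \<in> borel_measurable borel"
  using borel_measurable_integrable[of \<mu> u] by (simp add: measurable_cong_sets[OF sets_mu refl])

lemma measurable_orbit_integral [measurable]:
  assumes [measurable]: "\<phi> \<in> borel_measurable borel"
  shows "orbit_integral h \<phi> \<in> borel_measurable borel"
  unfolding orbit_integral_def set_lebesgue_integral_def by measurable

text \<open>The time average of \<open>\<phi>\<close> over \<open>[0, h]\<close> converges pointwise to \<open>\<phi>\<close>, since \<open>\<phi>\<close> is
  continuous along orbits.\<close>

lemma orbit_average_limit:
  fixes u \<phi> :: "real ^ 'n \<Rightarrow> real"
  assumes u: "integrable \<mu> u" and [measurable]: "\<phi> \<in> borel_measurable borel"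
    and bound: "\<And>x. \<bar>\<phi> x\<bar> \<le> B" and cont: "\<And>x. continuous_on UNIV (\<lambda>s. \<phi> (\<Phi> x s))"
  shows "(\<lambda>n. (\<integral>x. u x * orbit_integral (unit_fraction n) \<phi> x \<partial>\<mu>) / unit_fraction n) \<longlonglongrightarrow> (\<integral>x. u x * \<phi> x \<partial>\<mu>)"
proof -
  have [measurable]: "u \<in> borel_measurable borel" using u by (rule borel_of_integrable)
  have cont_rev: "continuous_on T (\<lambda>s. \<phi> (\<Phi> x (- s)))" for x T
    by (intro continuous_on_compose2[OF cont] continuous_intros) auto
  have "(\<lambda>n. \<integral>x. u x * (orbit_integral (unit_fraction n) \<phi> x / unit_fraction n) \<partial>\<mu>) \<longlonglongrightarrow> (\<integral>x. u x * \<phi> x \<partial>\<mu>)"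
  proof (rule integral_dominated_convergence)
    show "integrable \<mu> (\<lambda>x. \<bar>u x\<bar> * B)"
      using u by (intro integrable_mult_left integrable_abs)
    show "AE x in \<mu>. norm (u x * (orbit_integral (unit_fraction n) \<phi> x / unit_fraction n)) \<le> \<bar>u x\<bar> * B" for n
    proof (rule AE_I2)
      fix x
      have "orbit_integral (unit_fraction n) \<phi> x = integral {0..unit_fraction n} (\<lambda>s. \<phi> (\<Phi> x (- s)))"
        unfolding orbit_integral_def
        by (intro set_borel_integral_eq_integral borel_integrable_atLeastAtMost' cont_rev)
      then have "\<bar>orbit_integral (unit_fraction n) \<phi> x\<bar> \<le> B * unit_fraction n"
        using integral_bound[of 0 "unit_fraction n" "\<lambda>s. \<phi> (\<Phi> x (- s))" B] cont_rev bound unit_fraction(1)[of n]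
        by simp
      then have "\<bar>orbit_integral (unit_fraction n) \<phi> x / unit_fraction n\<bar> \<le> B"
        using unit_fraction(1)[of n] by (simp add: pos_divide_le_eq)
      then show "norm (u x * (orbit_integral (unit_fraction n) \<phi> x / unit_fraction n)) \<le> \<bar>u x\<bar> * B"
        unfolding real_norm_def abs_mult by (rule mult_left_mono) simp
    qed
    show "AE x in \<mu>. (\<lambda>n. u x * (orbit_integral (unit_fraction n) \<phi> x / unit_fraction n)) \<longlonglongrightarrow> u x * \<phi> x"
    proof (intro AE_I2 tendsto_mult tendsto_const)
      fix x
      show "(\<lambda>n. orbit_integral (unit_fraction n) \<phi> x / unit_fraction n) \<longlonglongrightarrow> \<phi> x"
        using tendsto_average[OF cont_rev unit_fraction, of x] by (simp add: orbit_integral_def)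
    qed
  qed measurable
  then show ?thesis by simp
qed

text \<open>Continuous functions with compact support need not be differentiable along the flow, but their
  averages over short times are test functions.\<close>

lemma zero_AE_if_orthogonal_test_functions:
  fixes u :: "real ^ 'n \<Rightarrow> real"
  assumes \<Omega>: "open \<Omega>" and u: "integrable \<mu> u"
    and orth: "\<And>\<psi>. \<psi> \<in> test_functions \<mu> \<Omega> \<Phi> \<Longrightarrow> (\<integral>x. u x * \<psi> x \<partial>\<mu>) = 0"
  shows "AE x in \<mu>. x \<in> \<Omega> \<longrightarrow> u x = 0"
proof (rule zero_AE_if_orthogonal[OF \<Omega> borel_of_integrable[OF u]])
  show "integrable \<mu> (\<lambda>x. indicator K x * u x)" if "compact K" for K
    using integrable_mult_indicator[OF _ u, of K] that
    by (simp add: sets_mu compact_imp_closed borel_closed)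
  fix \<phi> :: "real ^ 'n \<Rightarrow> real" and S :: "(real ^ 'n) set"
  assume \<phi>: "continuous_on UNIV \<phi>" "\<And>x. \<bar>\<phi> x\<bar> \<le> 1" "compact S" "S \<subseteq> \<Omega>" "\<And>x. \<phi> x \<noteq> 0 \<Longrightarrow> x \<in> S"
  obtain h where h: "0 < h" "S \<subseteq> stays \<Omega> h"
    using compact_subset_stays[OF \<Omega> \<phi>(3,4)] by blast
  have "\<forall>\<^sub>F n in sequentially. unit_fraction n < h"
    using unit_fraction(3) h(1) by (rule order_tendstoD)
  then have "\<forall>\<^sub>F n in sequentially. (\<integral>x. u x * orbit_integral (unit_fraction n) \<phi> x \<partial>\<mu>) / unit_fraction n = 0"
  proof eventually_elim
    case (elim n)
    have "orbit_integral (unit_fraction n) \<phi> \<in> test_functions \<mu> \<Omega> \<Phi>"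
    proof (rule orbit_integral_test_function[OF \<Omega> \<phi>(1) _ \<phi>(2,3) _ \<phi>(5)])
      show "S \<subseteq> stays \<Omega> (unit_fraction n)"
        using h(2) stays_mono[of "unit_fraction n" h] elim by fastforce
    qed (use unit_fraction(1) in \<open>auto intro: less_imp_le\<close>)
    then show ?case using orth by simp
  qed
  then have "(\<lambda>n. (\<integral>x. u x * orbit_integral (unit_fraction n) \<phi> x \<partial>\<mu>) / unit_fraction n) \<longlonglongrightarrow> 0"
    by (rule tendsto_eventually)
  moreover have "(\<lambda>n. (\<integral>x. u x * orbit_integral (unit_fraction n) \<phi> x \<partial>\<mu>) / unit_fraction n) \<longlonglongrightarrow> (\<integral>x. u x * \<phi> x \<partial>\<mu>)"
    by (rule orbit_average_limit[OF u _ \<phi>(2)])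
       (use \<phi>(1) in \<open>auto intro!: borel_measurable_continuous_onI continuous_on_compose2[OF \<phi>(1)] continuous_intros\<close>)
  ultimately show "(\<integral>x. u x * \<phi> x \<partial>\<mu>) = 0"
    by (rule LIMSEQ_unique[symmetric])
qed

section \<open>Weak and mild formulations\<close>

text \<open>Extended by zero, a test function is differentiable along the entire orbit, whether or not the
  orbit leaves \<open>\<Omega>\<close>: outside \<open>\<Omega>\<close> it vanishes near the current point because its
  support is a closed subset of \<open>\<Omega>\<close>. By the group law only time \<open>0\<close> has to be considered.\<close>

lemma test_function_along_flow:
  fixes \<psi> :: "real ^ 'n \<Rightarrow> real"
  assumes \<Omega>: "open \<Omega>" and \<psi>: "\<psi> \<in> test_functions \<mu> \<Omega> \<Phi>"
  shows "((\<lambda>s. indicator \<Omega> (\<Phi> x s) * \<psi> (\<Phi> x s)) has_real_derivative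
            indicator \<Omega> (\<Phi> x t) * flow_deriv \<Phi> \<psi> (\<Phi> x t)) (at t)"
proof -
  define K where "K = closure {x \<in> \<Omega>. \<psi> x \<noteq> 0}"
  have K: "closed K" "K \<subseteq> \<Omega>" "\<And>y. y \<in> \<Omega> \<Longrightarrow> y \<notin> K \<Longrightarrow> \<psi> y = 0"
    using \<psi> closure_subset[of "{x \<in> \<Omega>. \<psi> x \<noteq> 0}"] by (auto simp: K_def test_functions_def)
  have op: "open {s. \<Phi> y s \<in> A}" if "open A" for y A
    using open_vimage[OF that, of "\<Phi> y"] continuous_on_flow[OF continuous_on_const continuous_on_id, of UNIV y]
    by (simp add: vimage_def)
  have at0: "((\<lambda>s. indicator \<Omega> (\<Phi> y s) * \<psi> (\<Phi> y s)) has_real_derivative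
        indicator \<Omega> y * flow_deriv \<Phi> \<psi> y) (at 0)" for y
  proof (cases "y \<in> \<Omega>")
    case True
    obtain e where "0 < e" "ball 0 e \<subseteq> {s. \<Phi> y s \<in> \<Omega>}"
      using openE[OF op[OF \<Omega>, of y], of 0] True by auto
    then have e: "0 < e" "\<And>s. \<bar>s\<bar> < e \<Longrightarrow> \<Phi> y s \<in> \<Omega>"
      by (auto simp: ball_def dist_real_def)
    have "ereal e \<le> tau_plus \<Omega> \<Phi> y"
      unfolding tau_plus_def using e(2) by (intro INF_greatest) (force simp: not_less[symmetric])
    moreover have "ereal e \<le> tau_minus \<Omega> \<Phi> y"
      unfolding tau_minus_def using e(2) by (intro INF_greatest) (force simp: not_less[symmetric])
    ultimately have "0 < tau_plus \<Omega> \<Phi> y" "0 < tau_minus \<Omega> \<Phi> y"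
      using e(1) by (auto intro: less_le_trans[of 0 "ereal e"])
    then have "- tau_minus \<Omega> \<Phi> y < ereal 0" "ereal 0 < tau_plus \<Omega> \<Phi> y"
      by (simp_all add: zero_ereal_def[symmetric] ereal_uminus_less_reorder)
    then have "(\<lambda>s. \<psi> (\<Phi> y s)) differentiable (at 0)"
      using \<psi> True by (auto simp: test_functions_def C1_differentiable_on_eq)
    then have "((\<lambda>s. \<psi> (\<Phi> y s)) has_real_derivative flow_deriv \<Phi> \<psi> y) (at 0)"
      by (simp add: flow_deriv_def DERIV_deriv_iff_real_differentiable)
    then have "((\<lambda>s. indicator \<Omega> (\<Phi> y s) * \<psi> (\<Phi> y s)) has_real_derivative flow_deriv \<Phi> \<psi> y) (at 0)"
      by (rule has_field_derivative_transform_within_open[OF _ op[OF \<Omega>, of y]]) (use True in auto)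
    then show ?thesis using True by simp
  next
    case False
    have "((\<lambda>_. 0) has_real_derivative 0) (at 0)" by simp
    then have "((\<lambda>s. indicator \<Omega> (\<Phi> y s) * \<psi> (\<Phi> y s)) has_real_derivative 0) (at 0)"
      by (rule has_field_derivative_transform_within_open[OF _ op[of "- K" y]])
         (use K False in \<open>auto split: split_indicator\<close>)
    then show ?thesis using False by simp
  qed
  have "((\<lambda>s. indicator \<Omega> (\<Phi> (\<Phi> x t) s) * \<psi> (\<Phi> (\<Phi> x t) s)) has_real_derivative
        indicator \<Omega> (\<Phi> x t) * flow_deriv \<Phi> \<psi> (\<Phi> x t)) (at 0)"
    by (rule at0)
  then show ?thesis
    using DERIV_shift[of "\<lambda>s. indicator \<Omega> (\<Phi> x s) * \<psi> (\<Phi> x s)" _ 0 t] by (simp add: add.commute)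
qed

text \<open>The sign reflects that the operator is minus the derivative along the flow. Only orbits
  that stay in \<open>\<Omega>\<close> up to time \<open>h\<close> are constrained, since nothing is known of the
  equation outside \<open>\<Omega>\<close>.\<close>

definition satisfies_mild :: "(real ^ 'n) set \<Rightarrow> (real ^ 'n \<Rightarrow> real) \<Rightarrow> (real ^ 'n \<Rightarrow> real) \<Rightarrow> bool" where
  "satisfies_mild \<Omega> f g \<longleftrightarrow>
     (\<forall>h\<ge>0. AE x in \<mu>. x \<in> stays \<Omega> h \<longrightarrow> f (\<Phi> x h) = f x - (LBINT s:{0..h}. g (\<Phi> x s)))"

definition satisfies_weak :: "(real ^ 'n) set \<Rightarrow> (real ^ 'n \<Rightarrow> real) \<Rightarrow> (real ^ 'n \<Rightarrow> real) \<Rightarrow> bool" where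
  "satisfies_weak \<Omega> f g \<longleftrightarrow>
     (\<forall>\<psi>\<in>test_functions \<mu> \<Omega> \<Phi>. (\<integral>x. g x * \<psi> x \<partial>\<mu>) = (\<integral>x. f x * flow_deriv \<Phi> \<psi> x \<partial>\<mu>))"

text \<open>For fixed \<open>h\<close>, the defect of the mild identity is orthogonal to each continuous \<open>\<phi>\<close>
  with compact support in \<open>stays \<Omega> h\<close>: the weak equation, tested with the orbit integral of
  \<open>\<phi>\<close>, is this orthogonality once the flow is moved from \<open>\<phi>\<close> onto \<open>f\<close>
  and \<open>g\<close>. As \<open>f\<close> and \<open>g\<close> are only locally integrable, \<open>g\<close> is cut off to the
  compact \<open>tube\<close> swept out by the support before Fubini is used.\<close>

lemma mild_of_weak:
  fixes f g :: "real ^ 'n \<Rightarrow> real"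
  assumes \<Omega>: "open \<Omega>"
    and [measurable]: "f \<in> borel_measurable borel" "g \<in> borel_measurable borel"
    and f: "\<And>K. compact K \<Longrightarrow> integrable \<mu> (\<lambda>x. indicator K x * f x)"
    and g: "\<And>K. compact K \<Longrightarrow> integrable \<mu> (\<lambda>x. indicator K x * g x)"
    and weak: "satisfies_weak \<Omega> f g"
  shows "satisfies_mild \<Omega> f g"
  unfolding satisfies_mild_def
proof (intro allI impI)
  fix h :: real assume h: "0 \<le> h"
  define tube where "tube S = (\<lambda>z. \<Phi> (fst z) (snd z)) ` (S \<times> {0..h})" for S :: "(real ^ 'n) set"
  have tube_compact: "compact (tube S)" if "compact S" for S
    unfolding tube_def using that by (intro compact_continuous_image compact_Times continuous_intros) auto
  have tube: "\<Phi> x s \<in> tube S" if "x \<in> S" "0 \<le> s" "s \<le> h" for x s S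
    unfolding tube_def using that by (intro image_eqI[of _ _ "(x, s)"]) auto
  define gg where "gg S x = indicator (tube S) x * g x" for S x
  have gg: "integrable \<mu> (gg S)" if "compact S" for S
    unfolding gg_def by (intro g tube_compact that)
  have localize: "(LBINT s:{0..h}. g (\<Phi> x s)) = (LBINT s:{0..h}. gg S (\<Phi> x s))" if "x \<in> S" for x S
    using tube[OF that] unfolding gg_def
    by (intro set_lebesgue_integral_cong) auto
  let ?u = "\<lambda>x. f x - f (\<Phi> x h) - (LBINT s:{0..h}. g (\<Phi> x s))"
  have int_prod: "integrable \<mu> (\<lambda>x. v x * \<phi> x)"
    if "integrable \<mu> v" "\<phi> \<in> borel_measurable borel" "\<And>x. \<bar>\<phi> x\<bar> \<le> 1" for v \<phi> :: "real ^ 'n \<Rightarrow> real"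
    using that borel_of_integrable[OF that(1)]
    by (intro Bochner_Integration.integrable_bound[OF that(1)]) (auto simp: abs_mult mult_left_le)
  \<comment> \<open>For \<open>x \<in> S\<close> only values of \<open>f\<close> and \<open>g\<close> on the compact tube enter, where they are integrable.\<close>
  have parts: "integrable \<mu> (\<lambda>x. f x * \<phi> x)" "integrable \<mu> (\<lambda>x. f (\<Phi> x h) * \<phi> x)"
      "integrable \<mu> (\<lambda>x. (LBINT s:{0..h}. g (\<Phi> x s)) * \<phi> x)"
    if \<phi>: "\<phi> \<in> borel_measurable borel" "\<And>x. \<bar>\<phi> x\<bar> \<le> 1" "compact S" "\<And>x. \<phi> x \<noteq> 0 \<Longrightarrow> x \<in> S" for \<phi> S
  proof -
    have eq: "f x * \<phi> x = indicator S x * f x * \<phi> x"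
        "f (\<Phi> x h) * \<phi> x = indicator (tube S) (\<Phi> x h) * f (\<Phi> x h) * \<phi> x"
        "(LBINT s:{0..h}. g (\<Phi> x s)) * \<phi> x = \<phi> x * (LBINT s:{0..h}. gg S (\<Phi> x s))" for x
      using \<phi>(4)[of x] tube[of x S h] h localize[of x S] by (cases "\<phi> x = 0"; simp)+
    show "integrable \<mu> (\<lambda>x. f x * \<phi> x)"
      unfolding eq using \<phi> by (intro int_prod f)
    show "integrable \<mu> (\<lambda>x. f (\<Phi> x h) * \<phi> x)"
      unfolding eq using \<phi> tube_compact
      by (intro int_prod integrable_flow[of "\<lambda>x. indicator (tube S) x * f x"] f)
    show "integrable \<mu> (\<lambda>x. (LBINT s:{0..h}. g (\<Phi> x s)) * \<phi> x)"
      unfolding eq by (rule flow_duality(2)[OF gg[OF \<phi>(3)] \<phi>(1,2)])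
  qed
  have "AE x in \<mu>. x \<in> stays \<Omega> h \<longrightarrow> ?u x = 0"
  proof (rule zero_AE_if_orthogonal[OF open_stays[OF \<Omega>]])
    show "?u \<in> borel_measurable borel"
      unfolding set_lebesgue_integral_def by measurable
    show "integrable \<mu> (\<lambda>x. indicator K x * ?u x)" if K: "compact K" for K
    proof -
      have [measurable]: "K \<in> sets borel" using K by (simp add: compact_imp_closed borel_closed)
      have "integrable \<mu> (\<lambda>x. f x * indicator K x - f (\<Phi> x h) * indicator K x - (LBINT s:{0..h}. g (\<Phi> x s)) * indicator K x)"
        using K by (intro Bochner_Integration.integrable_diff parts[of _ K]) (auto split: split_indicator_asm)
      then show ?thesis by (simp add: algebra_simps)
    qed
    fix \<phi> :: "real ^ 'n \<Rightarrow> real" and S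
    assume cont: "continuous_on UNIV \<phi>" and bound: "\<And>x. \<bar>\<phi> x\<bar> \<le> 1"
      and S: "compact S" "S \<subseteq> stays \<Omega> h" and supp: "\<And>x. \<phi> x \<noteq> 0 \<Longrightarrow> x \<in> S"
    have [measurable]: "\<phi> \<in> borel_measurable borel"
      using cont by (rule borel_measurable_continuous_onI)
    have "\<phi> \<in> borel_measurable borel" by measurable
    note P = parts[where \<phi> = \<phi>, OF this bound S(1) supp]
    define \<psi> where "\<psi> = orbit_integral h \<phi>"
    have "\<psi> \<in> test_functions \<mu> \<Omega> \<Phi>"
      unfolding \<psi>_def using \<Omega> cont h bound S supp by (rule orbit_integral_test_function)
    then have "(\<integral>x. g x * \<psi> x \<partial>\<mu>) = (\<integral>x. f x * flow_deriv \<Phi> \<psi> x \<partial>\<mu>)"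
      using weak by (simp add: satisfies_weak_def)
    also have "\<dots> = (\<integral>x. f x * \<phi> x - f x * \<phi> (\<Phi> x (- h)) \<partial>\<mu>)"
      by (simp add: \<psi>_def flow_deriv_orbit_integral[OF cont h] algebra_simps)
    also have "\<dots> = (\<integral>x. f x * \<phi> x \<partial>\<mu>) - (\<integral>x. f x * \<phi> (\<Phi> x (- h)) \<partial>\<mu>)"
      using integrable_flow[OF P(2), of "- h"] P(1) by (intro Bochner_Integration.integral_diff) simp_all
    also have "(\<integral>x. f x * \<phi> (\<Phi> x (- h)) \<partial>\<mu>) = (\<integral>x. f (\<Phi> x h) * \<phi> x \<partial>\<mu>)"
      using integral_flow[of "\<lambda>x. f x * \<phi> (\<Phi> x (- h))" h] by simp
    finally have 1: "(\<integral>x. g x * \<psi> x \<partial>\<mu>) = (\<integral>x. f x * \<phi> x \<partial>\<mu>) - (\<integral>x. f (\<Phi> x h) * \<phi> x \<partial>\<mu>)" .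
    have \<psi>0: "\<psi> x = 0" if "x \<notin> tube S" for x
    proof -
      have "indicator {0..h} s *\<^sub>R \<phi> (\<Phi> x (- s)) = 0" for s
        using tube[OF supp, of "\<Phi> x (- s)" s] that by (auto split: split_indicator)
      then show ?thesis
        unfolding \<psi>_def orbit_integral_def set_lebesgue_integral_def
        by (simp del: real_scaleR_def scaleR_eq_0_iff)
    qed
    have "(\<integral>x. (LBINT s:{0..h}. g (\<Phi> x s)) * \<phi> x \<partial>\<mu>) = (\<integral>x. \<phi> x * (LBINT s:{0..h}. gg S (\<Phi> x s)) \<partial>\<mu>)"
    proof (rule Bochner_Integration.integral_cong)
      fix x show "(LBINT s:{0..h}. g (\<Phi> x s)) * \<phi> x = \<phi> x * (LBINT s:{0..h}. gg S (\<Phi> x s))"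
        using supp[of x] localize[of x S] by (cases "\<phi> x = 0") auto
    qed simp
    also have "\<dots> = (\<integral>x. gg S x * \<psi> x \<partial>\<mu>)"
      unfolding \<psi>_def orbit_integral_def by (rule flow_duality(1)[OF gg[OF S(1)] _ bound]) simp
    also have "\<dots> = (\<integral>x. g x * \<psi> x \<partial>\<mu>)"
      using \<psi>0 by (intro Bochner_Integration.integral_cong) (auto simp: gg_def split: split_indicator)
    finally have 2: "(\<integral>x. (LBINT s:{0..h}. g (\<Phi> x s)) * \<phi> x \<partial>\<mu>) = (\<integral>x. g x * \<psi> x \<partial>\<mu>)" .
    have "(\<integral>x. ?u x * \<phi> x \<partial>\<mu>) = (\<integral>x. f x * \<phi> x - f (\<Phi> x h) * \<phi> x - (LBINT s:{0..h}. g (\<Phi> x s)) * \<phi> x \<partial>\<mu>)"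
      by (simp add: algebra_simps)
    also have "\<dots> = (\<integral>x. f x * \<phi> x \<partial>\<mu>) - (\<integral>x. f (\<Phi> x h) * \<phi> x \<partial>\<mu>) - (\<integral>x. (LBINT s:{0..h}. g (\<Phi> x s)) * \<phi> x \<partial>\<mu>)"
      using P by simp
    finally show "(\<integral>x. ?u x * \<phi> x \<partial>\<mu>) = 0"
      using 1 2 by simp
  qed
  then show "AE x in \<mu>. x \<in> stays \<Omega> h \<longrightarrow> f (\<Phi> x h) = f x - (LBINT s:{0..h}. g (\<Phi> x s))"
    by eventually_elim auto
qed

text \<open>With \<open>\<psi>\<^sub>0\<close> the test function extended by zero, invariance gives
  \<open>\<integral> f (\<psi>\<^sub>0 - \<psi>\<^sub>0 \<circ> \<Phi>(\<cdot>, - h)) = \<integral> (f - f \<circ> \<Phi>(\<cdot>, h)) \<psi>\<^sub>0\<close>. For small \<open>h\<close> the support of \<open>\<psi>\<^sub>0\<close>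
  lies in \<open>stays \<Omega> h\<close>, so the mild identity and duality turn the right-hand side into
  \<open>\<integral> g (orbit_integral h \<psi>\<^sub>0)\<close>. Divide by \<open>h\<close> and let \<open>h\<close> tend to \<open>0\<close>. Dominated
  convergence applies on the left because the derivative of \<open>\<psi>\<^sub>0\<close> along the flow is bounded.\<close>

lemma weak_of_mild:
  fixes f g :: "real ^ 'n \<Rightarrow> real"
  assumes \<Omega>: "open \<Omega>" and f: "integrable \<mu> f" and g: "integrable \<mu> g"
    and out: "\<And>x. x \<notin> \<Omega> \<Longrightarrow> f x = 0" "\<And>x. x \<notin> \<Omega> \<Longrightarrow> g x = 0"
    and mild: "satisfies_mild \<Omega> f g"
  shows "satisfies_weak \<Omega> f g"
  unfolding satisfies_weak_def
proof
  fix \<psi> assume \<psi>: "\<psi> \<in> test_functions \<mu> \<Omega> \<Phi>"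
  have [measurable]: "f \<in> borel_measurable borel" "g \<in> borel_measurable borel"
    using f g by (auto intro: borel_of_integrable)
  define \<psi>0 where "\<psi>0 x = indicator \<Omega> x * \<psi> x" for x
  define D where "D x = indicator \<Omega> x * flow_deriv \<Phi> \<psi> x" for x
  define K where "K = closure {x \<in> \<Omega>. \<psi> x \<noteq> 0}"
  have K: "compact K" "K \<subseteq> \<Omega>" and K0: "\<And>x. \<psi>0 x \<noteq> 0 \<Longrightarrow> x \<in> K"
    using \<psi> closure_subset[of "{x \<in> \<Omega>. \<psi> x \<noteq> 0}"]
    by (auto simp: K_def \<psi>0_def test_functions_def split: split_indicator_asm)
  have [measurable]: "\<psi>0 \<in> borel_measurable borel" "D \<in> borel_measurable borel"
    using \<psi> unfolding \<psi>0_def[abs_def] D_def[abs_def]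
    by (auto simp: test_functions_def set_borel_measurable_def measurable_cong_sets[OF sets_mu refl])
  obtain B where "\<And>x. x \<in> \<Omega> \<Longrightarrow> \<bar>\<psi> x\<bar> \<le> B"
    using \<psi> by (fastforce simp: test_functions_def bounded_iff)
  then have B: "\<bar>\<psi>0 x\<bar> \<le> \<bar>B\<bar>" for x
    by (fastforce simp: \<psi>0_def split: split_indicator)
  obtain M where "\<And>x. x \<in> \<Omega> \<Longrightarrow> \<bar>flow_deriv \<Phi> \<psi> x\<bar> \<le> M"
    using \<psi> by (fastforce simp: test_functions_def bounded_iff)
  then have M: "\<bar>D x\<bar> \<le> \<bar>M\<bar>" for x
    by (fastforce simp: D_def split: split_indicator)
  have deriv: "((\<lambda>s. \<psi>0 (\<Phi> x s)) has_real_derivative D (\<Phi> x t)) (at t)" for x t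
    unfolding \<psi>0_def D_def by (rule test_function_along_flow[OF \<Omega> \<psi>])
  have lipschitz: "\<bar>\<psi>0 x - \<psi>0 (\<Phi> x (- h))\<bar> \<le> \<bar>M\<bar> * h" if h: "0 < h" for x h
  proof -
    obtain z where "\<psi>0 (\<Phi> x 0) - \<psi>0 (\<Phi> x (- h)) = (0 - (- h)) * D (\<Phi> x z)"
      using MVT2[of "- h" 0 "\<lambda>s. \<psi>0 (\<Phi> x s)" "\<lambda>s. D (\<Phi> x s)"] deriv h by auto
    then have "\<bar>\<psi>0 x - \<psi>0 (\<Phi> x (- h))\<bar> = h * \<bar>D (\<Phi> x z)\<bar>"
      using h by (simp add: abs_mult)
    also have "\<dots> \<le> h * \<bar>M\<bar>" using M h by (intro mult_left_mono) auto
    finally show ?thesis by (simp add: mult.commute)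
  qed
  have int_f\<psi>: "integrable \<mu> (\<lambda>x. v x * \<psi>0 (\<Phi> x t))" if v: "integrable \<mu> v" for v t
    by (rule Bochner_Integration.integrable_bound[OF integrable_mult_left[OF v, of "\<bar>B\<bar>"]])
       (use B borel_of_integrable[OF v] in \<open>auto simp: abs_mult intro!: AE_I2 mult_left_mono\<close>)
  let ?h = unit_fraction
  have left: "(\<lambda>n. \<integral>x. f x * ((\<psi>0 x - \<psi>0 (\<Phi> x (- ?h n))) / ?h n) \<partial>\<mu>) \<longlonglongrightarrow> (\<integral>x. f x * D x \<partial>\<mu>)"
  proof (rule integral_dominated_convergence)
    show "integrable \<mu> (\<lambda>x. \<bar>f x\<bar> * \<bar>M\<bar>)"
      using f by (intro integrable_mult_left integrable_abs)
    show "AE x in \<mu>. norm (f x * ((\<psi>0 x - \<psi>0 (\<Phi> x (- ?h n))) / ?h n)) \<le> \<bar>f x\<bar> * \<bar>M\<bar>" for n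
    proof (rule AE_I2)
      fix x
      have "\<bar>(\<psi>0 x - \<psi>0 (\<Phi> x (- ?h n))) / ?h n\<bar> \<le> \<bar>M\<bar>"
        using lipschitz[OF unit_fraction(1), of x n] unit_fraction(1)[of n] by (simp add: pos_divide_le_eq)
      then show "norm (f x * ((\<psi>0 x - \<psi>0 (\<Phi> x (- ?h n))) / ?h n)) \<le> \<bar>f x\<bar> * \<bar>M\<bar>"
        unfolding real_norm_def abs_mult by (rule mult_left_mono) simp
    qed
    show "AE x in \<mu>. (\<lambda>n. f x * ((\<psi>0 x - \<psi>0 (\<Phi> x (- ?h n))) / ?h n)) \<longlonglongrightarrow> f x * D x"
    proof (intro AE_I2 tendsto_mult tendsto_const)
      fix x
      have "(\<lambda>n. (\<psi>0 (\<Phi> x (- ?h n)) - \<psi>0 (\<Phi> x 0)) / - ?h n) \<longlonglongrightarrow> D (\<Phi> x 0)"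
      proof (rule tendsto_difference_quotient[where S = UNIV])
        show "(\<lambda>n. - ?h n) \<longlonglongrightarrow> 0" using tendsto_minus[OF unit_fraction(3)] by simp
        show "((\<lambda>s. \<psi>0 (\<Phi> x s)) has_real_derivative D (\<Phi> x 0)) (at 0)" by (rule deriv)
        show "- ?h n \<in> UNIV - {0}" for n using unit_fraction(1)[of n] by simp
      qed
      then show "(\<lambda>n. (\<psi>0 x - \<psi>0 (\<Phi> x (- ?h n))) / ?h n) \<longlonglongrightarrow> D x"
        by (simp add: minus_divide_left)
    qed
  qed measurable
  have right: "(\<lambda>n. (\<integral>x. g x * orbit_integral (?h n) \<psi>0 x \<partial>\<mu>) / ?h n) \<longlonglongrightarrow> (\<integral>x. g x * \<psi>0 x \<partial>\<mu>)"
  proof (rule orbit_average_limit[OF g _ B])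
    show "continuous_on UNIV (\<lambda>s. \<psi>0 (\<Phi> x s))" for x
      using deriv by (rule DERIV_continuous_on)
  qed measurable
  obtain h0 where h0: "0 < h0" "K \<subseteq> stays \<Omega> h0"
    using compact_subset_stays[OF \<Omega> K] by blast
  have "\<forall>\<^sub>F n in sequentially. ?h n < h0"
    using unit_fraction(3) h0(1) by (rule order_tendstoD)
  then have "\<forall>\<^sub>F n in sequentially. (\<integral>x. f x * ((\<psi>0 x - \<psi>0 (\<Phi> x (- ?h n))) / ?h n) \<partial>\<mu>)
      = (\<integral>x. g x * orbit_integral (?h n) \<psi>0 x \<partial>\<mu>) / ?h n"
  proof eventually_elim
    case (elim n)
    have "(\<integral>x. f x * (\<psi>0 x - \<psi>0 (\<Phi> x (- ?h n))) \<partial>\<mu>) = (\<integral>x. f x * \<psi>0 x \<partial>\<mu>) - (\<integral>x. f x * \<psi>0 (\<Phi> x (- ?h n)) \<partial>\<mu>)"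
      using int_f\<psi>[OF f, of 0] int_f\<psi>[OF f, of "- ?h n"] by (simp add: right_diff_distrib)
    also have "(\<integral>x. f x * \<psi>0 (\<Phi> x (- ?h n)) \<partial>\<mu>) = (\<integral>x. f (\<Phi> x (?h n)) * \<psi>0 x \<partial>\<mu>)"
      using integral_flow[of "\<lambda>x. f x * \<psi>0 (\<Phi> x (- ?h n))" "?h n"] by simp
    also have "(\<integral>x. f x * \<psi>0 x \<partial>\<mu>) - \<dots> = (\<integral>x. (f x - f (\<Phi> x (?h n))) * \<psi>0 x \<partial>\<mu>)"
      using int_f\<psi>[OF f, of 0] int_f\<psi>[OF integrable_flow[OF f], of "?h n" 0] by (simp add: left_diff_distrib)
    also have "\<dots> = (\<integral>x. \<psi>0 x * (LBINT s:{0..?h n}. g (\<Phi> x s)) \<partial>\<mu>)"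
    proof (rule integral_cong_AE)
      have "AE x in \<mu>. x \<in> stays \<Omega> (?h n) \<longrightarrow> f (\<Phi> x (?h n)) = f x - (LBINT s:{0..?h n}. g (\<Phi> x s))"
        using mild unit_fraction(1)[of n] by (simp add: satisfies_mild_def)
      then show "AE x in \<mu>. (f x - f (\<Phi> x (?h n))) * \<psi>0 x = \<psi>0 x * (LBINT s:{0..?h n}. g (\<Phi> x s))"
      proof eventually_elim
        case (elim x)
        have "x \<in> stays \<Omega> (?h n)" if "\<psi>0 x \<noteq> 0"
          using K0[OF that] h0(2) stays_mono[OF less_imp_le, OF \<open>?h n < h0\<close>] by blast
        then show ?case using elim by (cases "\<psi>0 x = 0") auto
      qed
    qed (unfold set_lebesgue_integral_def, measurable)
    also have "\<dots> = (\<integral>x. g x * orbit_integral (?h n) \<psi>0 x \<partial>\<mu>)"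
      unfolding orbit_integral_def by (rule flow_duality(1)[OF g _ B]) simp
    finally show ?case by simp
  qed
  from Lim_transform_eventually[OF left this]
  have "(\<integral>x. g x * \<psi>0 x \<partial>\<mu>) = (\<integral>x. f x * D x \<partial>\<mu>)"
    by (rule LIMSEQ_unique[OF right])
  moreover have "g x * \<psi>0 x = g x * \<psi> x" "f x * D x = f x * flow_deriv \<Phi> \<psi> x" for x
    using out by (auto simp: \<psi>0_def D_def split: split_indicator)
  ultimately show "(\<integral>x. g x * \<psi> x \<partial>\<mu>) = (\<integral>x. f x * flow_deriv \<Phi> \<psi> x \<partial>\<mu>)"
    by simp
qed

section \<open>Powers of solutions\<close>

text \<open>The mild identity holds, for each time, at almost every point; Fubini exchanges the
  quantifiers. On almost every orbit \<open>f\<close> then coincides at almost all times with the indefinite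
  integral \<open>w\<close>, and the one-dimensional chain rule applies to \<open>w\<close>. The mild identity at
  the end time \<open>h\<close> itself is added separately, since \<open>h\<close> might be an exceptional time.\<close>

lemma mild_abs_powr:
  fixes f g :: "real ^ 'n \<Rightarrow> real"
  assumes \<Omega>: "open \<Omega>" and p: "1 \<le> p"
    and [measurable]: "f \<in> borel_measurable borel" "g \<in> borel_measurable borel"
    and g: "integrable \<mu> (\<lambda>x. \<bar>g x\<bar> powr p)"
    and G: "integrable \<mu> (\<lambda>x. p * sgn (f x) * \<bar>f x\<bar> powr (p - 1) * g x)"
    and mild: "satisfies_mild \<Omega> f g"
  shows "satisfies_mild \<Omega> (\<lambda>x. \<bar>f x\<bar> powr p) (\<lambda>x. p * sgn (f x) * \<bar>f x\<bar> powr (p - 1) * g x)"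
  unfolding satisfies_mild_def
proof (intro allI impI)
  fix h :: real assume h: "0 \<le> h"
  have [measurable]: "stays \<Omega> h \<in> sets borel" using open_stays[OF \<Omega>] by simp
  have "AE s in lborel. AE x in \<mu>. x \<in> stays \<Omega> h \<and> s \<in> {0..h} \<longrightarrow>
      f (\<Phi> x s) = f x - (LBINT r:{0..s}. g (\<Phi> x r))"
  proof (rule AE_I2)
    fix s
    show "AE x in \<mu>. x \<in> stays \<Omega> h \<and> s \<in> {0..h} \<longrightarrow> f (\<Phi> x s) = f x - (LBINT r:{0..s}. g (\<Phi> x r))"
    proof (cases "s \<in> {0..h}")
      case True
      then have "AE x in \<mu>. x \<in> stays \<Omega> s \<longrightarrow> f (\<Phi> x s) = f x - (LBINT r:{0..s}. g (\<Phi> x r))"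
        using mild by (simp add: satisfies_mild_def)
      then show ?thesis
        by eventually_elim (use stays_mono[of s h \<Omega>] True in auto)
    qed (auto intro: AE_I2)
  qed
  then have "AE x in \<mu>. AE s in lborel. x \<in> stays \<Omega> h \<and> s \<in> {0..h} \<longrightarrow>
      f (\<Phi> x s) = f x - (LBINT r:{0..s}. g (\<Phi> x r))"
  proof (subst (asm) time_space.AE_commute)
    have ind: "indicator {0..s} r = (if 0 \<le> r \<and> r \<le> s then 1 else 0 :: real)" for r s :: real
      by (simp add: indicator_def)
    have [measurable]: "(\<lambda>z. LBINT r:{0..fst z}. g (\<Phi> (snd z) r)) \<in> borel_measurable (lborel \<Otimes>\<^sub>M \<mu>)"
      unfolding set_lebesgue_integral_def ind by measurable
    show "{z \<in> space (lborel \<Otimes>\<^sub>M \<mu>). snd z \<in> stays \<Omega> h \<and> fst z \<in> {0..h} \<longrightarrow>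
        f (\<Phi> (snd z) (fst z)) = f (snd z) - (LBINT r:{0..fst z}. g (\<Phi> (snd z) r))} \<in> sets (lborel \<Otimes>\<^sub>M \<mu>)"
      by measurable
  qed
  moreover have "AE x in \<mu>. x \<in> stays \<Omega> h \<longrightarrow> f (\<Phi> x h) = f x - (LBINT s:{0..h}. g (\<Phi> x s))"
    using mild h by (simp add: satisfies_mild_def)
  moreover note AE_orbit_integrable[OF g, of h] AE_orbit_integrable[OF G, of h]
  ultimately show "AE x in \<mu>. x \<in> stays \<Omega> h \<longrightarrow> \<bar>f (\<Phi> x h)\<bar> powr p = \<bar>f x\<bar> powr p -
      (LBINT s:{0..h}. p * sgn (f (\<Phi> x s)) * \<bar>f (\<Phi> x s)\<bar> powr (p - 1) * g (\<Phi> x s))"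
  proof eventually_elim
    case (elim x)
    show ?case
    proof
      assume x: "x \<in> stays \<Omega> h"
      note le = abs_le_one_plus_powr[OF p]
      have g_int: "set_integrable lborel {0..h} (\<lambda>s. g (\<Phi> x s))"
      proof (rule set_integrable_bound)
        have "set_integrable lborel {0..h} (\<lambda>s. 1 :: real)"
          by (intro borel_integrable_atLeastAtMost' continuous_intros)
        then show "set_integrable lborel {0..h} (\<lambda>s. 1 + \<bar>g (\<Phi> x s)\<bar> powr p)"
          using elim by (intro set_integral_add)
        show "set_borel_measurable lborel {0..h} (\<lambda>s. g (\<Phi> x s))"
          unfolding set_borel_measurable_def by measurable
        show "AE s in lborel. s \<in> {0..h} \<longrightarrow> norm (g (\<Phi> x s)) \<le> norm (1 + \<bar>g (\<Phi> x s)\<bar> powr p)"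
          using le by (auto intro!: order_trans[OF le])
      qed
      define u where "u s = - g (\<Phi> x s)" for s
      define w where "w t = f x + integral {0..t} u" for t
      have u_int: "set_integrable lborel {0..h} u"
        using g_int by (simp add: u_def set_integrable_def)
      have u_abs: "u absolutely_integrable_on {0..h}"
      proof -
        have "set_integrable lborel {0..h} (\<lambda>s. \<bar>u s\<bar>)"
          using u_int by (rule set_integrable_abs)
        then show ?thesis
          using u_int by (auto simp: absolutely_integrable_on_def dest: set_borel_integral_eq_integral(1))
      qed
      have w: "f x - (LBINT r:{0..s}. g (\<Phi> x r)) = w s" if "s \<in> {0..h}" for s
      proof -
        have "set_integrable lborel {0..s} u"
          using set_integrable_subset[OF u_int, of "{0..s}"] that by simp
        then have "(LBINT r:{0..s}. u r) = integral {0..s} u"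
          by (rule set_borel_integral_eq_integral)
        then show ?thesis
          by (simp add: w_def u_def set_lebesgue_integral_def)
      qed
      have ae: "AE s in lborel. s \<in> {0..h} \<longrightarrow> f (\<Phi> x s) = w s"
        using elim(1) x w by simp
      have "integral {0..h} (\<lambda>s. p * sgn (f (\<Phi> x s)) * \<bar>f (\<Phi> x s)\<bar> powr (p - 1) * u s)
          = integral {0..h} (\<lambda>s. p * sgn (w s) * \<bar>w s\<bar> powr (p - 1) * u s)"
      proof -
        have "AE s in lborel. s \<in> {0..h} \<longrightarrow>
            p * sgn (f (\<Phi> x s)) * \<bar>f (\<Phi> x s)\<bar> powr (p - 1) * u s = p * sgn (w s) * \<bar>w s\<bar> powr (p - 1) * u s"
          using ae by eventually_elim auto
        from has_integral_AE[OF this] show ?thesis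
          by (simp add: integral_def integrable_on_def)
      qed
      also have "\<dots> = \<bar>w h\<bar> powr p - \<bar>f x\<bar> powr p"
        unfolding w_def by (rule chain_rule_abs_powr[OF h p u_abs])
      finally have "\<bar>w h\<bar> powr p - \<bar>f x\<bar> powr p =
          - integral {0..h} (\<lambda>s. p * sgn (f (\<Phi> x s)) * \<bar>f (\<Phi> x s)\<bar> powr (p - 1) * g (\<Phi> x s))"
        by (simp add: u_def)
      also have "integral {0..h} (\<lambda>s. p * sgn (f (\<Phi> x s)) * \<bar>f (\<Phi> x s)\<bar> powr (p - 1) * g (\<Phi> x s)) =
          (LBINT s:{0..h}. p * sgn (f (\<Phi> x s)) * \<bar>f (\<Phi> x s)\<bar> powr (p - 1) * g (\<Phi> x s))"
        using elim by (intro set_borel_integral_eq_integral(2)[symmetric])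
      finally show "\<bar>f (\<Phi> x h)\<bar> powr p = \<bar>f x\<bar> powr p -
          (LBINT s:{0..h}. p * sgn (f (\<Phi> x s)) * \<bar>f (\<Phi> x s)\<bar> powr (p - 1) * g (\<Phi> x s))"
        using elim(2) x w[of h] h by simp
    qed
  qed
qed

section \<open>The maximal operator\<close>

text \<open>Passing to the extensions by zero replaces every integral over \<open>\<Omega>\<close> by an integral over the
  whole space, where the invariance of the measure can be used.\<close>

lemma T_max_rel_iff:
  fixes f g :: "real ^ 'n \<Rightarrow> real"
  assumes p: "0 < p"
  shows "T_max_rel \<mu> \<Omega> \<Phi> p f g \<longleftrightarrow>
    (let f\<^sub>0 = (\<lambda>x. indicator \<Omega> x * f x); g\<^sub>0 = (\<lambda>x. indicator \<Omega> x * g x) in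
     f\<^sub>0 \<in> borel_measurable borel \<and> integrable \<mu> (\<lambda>x. \<bar>f\<^sub>0 x\<bar> powr p) \<and>
     g\<^sub>0 \<in> borel_measurable borel \<and> integrable \<mu> (\<lambda>x. \<bar>g\<^sub>0 x\<bar> powr p) \<and> satisfies_weak \<Omega> f\<^sub>0 g\<^sub>0)"
proof -
  have "indicator \<Omega> x * \<bar>v x\<bar> powr p = \<bar>indicator \<Omega> x * v x\<bar> powr p" for v :: "real ^ 'n \<Rightarrow> real" and x
    using p by (simp split: split_indicator)
  then have "v \<in> Lp \<mu> \<Omega> p \<longleftrightarrow> (\<lambda>x. indicator \<Omega> x * v x) \<in> borel_measurable borel \<and>
      integrable \<mu> (\<lambda>x. \<bar>indicator \<Omega> x * v x\<bar> powr p)" for v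
    by (simp add: Lp_def set_borel_measurable_def set_integrable_def measurable_cong_sets[OF sets_mu refl])
  then show ?thesis
    by (auto simp: T_max_rel_def satisfies_weak_def set_lebesgue_integral_def mult.assoc Let_def)
qed

lemma T_max_rel_unique:
  assumes \<Omega>: "open \<Omega>" and rel: "T_max_rel \<mu> \<Omega> \<Phi> 1 f g\<^sub>1" "T_max_rel \<mu> \<Omega> \<Phi> 1 f g\<^sub>2"
  shows "AE x\<in>\<Omega> in \<mu>. g\<^sub>1 x = g\<^sub>2 x"
proof -
  define v where "v g x = indicator \<Omega> x * g x" for g :: "real ^ 'n \<Rightarrow> real" and x
  have v: "integrable \<mu> (v g)" if "T_max_rel \<mu> \<Omega> \<Phi> 1 f g" for g
    using that integrable_abs_cancel[of \<mu> "v g"]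
    by (auto simp: T_max_rel_iff Let_def v_def[abs_def] measurable_cong_sets[OF sets_mu refl])
  have "AE x in \<mu>. x \<in> \<Omega> \<longrightarrow> v g\<^sub>1 x - v g\<^sub>2 x = 0"
  proof (rule zero_AE_if_orthogonal_test_functions[OF \<Omega>])
    show "integrable \<mu> (\<lambda>x. v g\<^sub>1 x - v g\<^sub>2 x)"
      using v rel by (intro Bochner_Integration.integrable_diff)
    fix \<psi> assume \<psi>: "\<psi> \<in> test_functions \<mu> \<Omega> \<Phi>"
    obtain B where B: "\<And>x. x \<in> \<Omega> \<Longrightarrow> \<bar>\<psi> x\<bar> \<le> B"
      using \<psi> by (fastforce simp: test_functions_def bounded_iff)
    have [measurable]: "(\<lambda>x. indicator \<Omega> x * \<psi> x) \<in> borel_measurable borel"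
      using \<psi> by (auto simp: test_functions_def set_borel_measurable_def measurable_cong_sets[OF sets_mu refl])
    have int: "integrable \<mu> (\<lambda>x. v g x * \<psi> x)" if g: "T_max_rel \<mu> \<Omega> \<Phi> 1 f g" for g
    proof (rule Bochner_Integration.integrable_bound[OF integrable_mult_right[OF v[OF g], of B]])
      have [measurable]: "v g \<in> borel_measurable borel" using v[OF g] by (rule borel_of_integrable)
      have eq: "v g x * \<psi> x = v g x * (indicator \<Omega> x * \<psi> x)" for x
        by (simp add: v_def split: split_indicator)
      show "(\<lambda>x. v g x * \<psi> x) \<in> borel_measurable \<mu>"
        unfolding eq by measurable
      show "AE x in \<mu>. norm (v g x * \<psi> x) \<le> norm (B * v g x)"
      proof (rule AE_I2)
        fix x
        show "norm (v g x * \<psi> x) \<le> norm (B * v g x)"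
          using B[of x] mult_right_mono[of "\<bar>\<psi> x\<bar>" "\<bar>B\<bar>" "\<bar>v g x\<bar>"]
          by (cases "x \<in> \<Omega>") (auto simp: abs_mult mult.commute v_def)
      qed
    qed
    have "(\<integral>x. v g\<^sub>1 x * \<psi> x \<partial>\<mu>) = (\<integral>x. v g\<^sub>2 x * \<psi> x \<partial>\<mu>)"
      using rel \<psi> by (simp add: T_max_rel_iff Let_def v_def satisfies_weak_def)
    then show "(\<integral>x. (v g\<^sub>1 x - v g\<^sub>2 x) * \<psi> x \<partial>\<mu>) = 0"
      using int[OF rel(1)] int[OF rel(2)] by (simp add: left_diff_distrib)
  qed
  then show ?thesis
    by eventually_elim (auto simp: v_def)
qed

lemma T_max_rel_abs_powr:
  assumes \<Omega>: "open \<Omega>" and p: "1 \<le> p" and rel: "T_max_rel \<mu> \<Omega> \<Phi> p f g"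
  shows "T_max_rel \<mu> \<Omega> \<Phi> 1 (\<lambda>x. \<bar>f x\<bar> powr p) (\<lambda>x. p * sgn (f x) * \<bar>f x\<bar> powr (p - 1) * g x)"
proof -
  define f\<^sub>0 where "f\<^sub>0 x = indicator \<Omega> x * f x" for x
  define g\<^sub>0 where "g\<^sub>0 x = indicator \<Omega> x * g x" for x
  define G where "G x = p * sgn (f\<^sub>0 x) * \<bar>f\<^sub>0 x\<bar> powr (p - 1) * g\<^sub>0 x" for x
  have [measurable]: "f\<^sub>0 \<in> borel_measurable borel" "g\<^sub>0 \<in> borel_measurable borel"
    and fp: "integrable \<mu> (\<lambda>x. \<bar>f\<^sub>0 x\<bar> powr p)" and gp: "integrable \<mu> (\<lambda>x. \<bar>g\<^sub>0 x\<bar> powr p)"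
    and weak: "satisfies_weak \<Omega> f\<^sub>0 g\<^sub>0"
    using rel p by (simp_all add: T_max_rel_iff Let_def f\<^sub>0_def[abs_def] g\<^sub>0_def[abs_def])
  have [measurable]: "G \<in> borel_measurable borel"
    unfolding G_def[abs_def] by measurable
  have loc: "integrable \<mu> (\<lambda>x. indicator K x * v x)"
    if K: "compact K" and [measurable]: "v \<in> borel_measurable borel" and v: "integrable \<mu> (\<lambda>x. \<bar>v x\<bar> powr p)" for K v
  proof (rule Bochner_Integration.integrable_bound)
    have [measurable]: "K \<in> sets borel" using K by (simp add: compact_imp_closed borel_closed)
    show "integrable \<mu> (\<lambda>x. indicator K x * 1 + \<bar>v x\<bar> powr p)"
      using integrable_const_on_compact[OF K, of 1] v by (rule Bochner_Integration.integrable_add)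
    show "(\<lambda>x. indicator K x * v x) \<in> borel_measurable \<mu>" by measurable
    show "AE x in \<mu>. norm (indicator K x * v x) \<le> norm (indicator K x * 1 + \<bar>v x\<bar> powr p)"
      using abs_le_one_plus_powr[OF p] by (auto simp: abs_mult intro!: AE_I2 split: split_indicator)
  qed
  have "integrable \<mu> G"
  proof (rule Bochner_Integration.integrable_bound)
    show "integrable \<mu> (\<lambda>x. p * (\<bar>f\<^sub>0 x\<bar> powr p + \<bar>g\<^sub>0 x\<bar> powr p))"
      using fp gp by (intro integrable_mult_right Bochner_Integration.integrable_add)
    show "AE x in \<mu>. norm (G x) \<le> norm (p * (\<bar>f\<^sub>0 x\<bar> powr p + \<bar>g\<^sub>0 x\<bar> powr p))"
    proof (rule AE_I2)
      fix x
      have "\<bar>sgn (f\<^sub>0 x)\<bar> * (\<bar>f\<^sub>0 x\<bar> powr (p - 1) * \<bar>g\<^sub>0 x\<bar>) \<le> \<bar>f\<^sub>0 x\<bar> powr p + \<bar>g\<^sub>0 x\<bar> powr p"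
        using powr_mult_le_sum_powr[OF p, of "\<bar>f\<^sub>0 x\<bar>" "\<bar>g\<^sub>0 x\<bar>"] by (cases "f\<^sub>0 x = 0") (auto simp: abs_sgn_eq)
      then have "p * (\<bar>sgn (f\<^sub>0 x)\<bar> * (\<bar>f\<^sub>0 x\<bar> powr (p - 1) * \<bar>g\<^sub>0 x\<bar>)) \<le> p * (\<bar>f\<^sub>0 x\<bar> powr p + \<bar>g\<^sub>0 x\<bar> powr p)"
        using p by (intro mult_left_mono) auto
      then show "norm (G x) \<le> norm (p * (\<bar>f\<^sub>0 x\<bar> powr p + \<bar>g\<^sub>0 x\<bar> powr p))"
        using p by (simp add: G_def abs_mult mult.assoc)
    qed
  qed measurable
  have "satisfies_mild \<Omega> f\<^sub>0 g\<^sub>0"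
    by (rule mild_of_weak[OF \<Omega> _ _ _ _ weak]) (use fp gp in \<open>auto intro: loc\<close>)
  from mild_abs_powr[OF \<Omega> p _ _ gp _ this] \<open>integrable \<mu> G\<close>
  have "satisfies_mild \<Omega> (\<lambda>x. \<bar>f\<^sub>0 x\<bar> powr p) G"
    by (simp add: G_def[abs_def])
  then have "satisfies_weak \<Omega> (\<lambda>x. \<bar>f\<^sub>0 x\<bar> powr p) G"
    using \<open>integrable \<mu> G\<close> fp p by (intro weak_of_mild[OF \<Omega>]) (auto simp: G_def f\<^sub>0_def)
  moreover have "indicator \<Omega> x * \<bar>f x\<bar> powr p = \<bar>f\<^sub>0 x\<bar> powr p"
    "indicator \<Omega> x * (p * sgn (f x) * \<bar>f x\<bar> powr (p - 1) * g x) = G x" for x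
    using p by (auto simp: f\<^sub>0_def g\<^sub>0_def G_def split: split_indicator)
  ultimately show ?thesis
    using fp \<open>integrable \<mu> G\<close> by (simp add: T_max_rel_iff Let_def)
qed

end

theorem theorem2p8:
  fixes \<mu> :: "(real ^ 'n) measure"
    and \<Omega> :: "(real ^ 'n) set"
    and F :: "real ^ 'n \<Rightarrow> real ^ 'n"
    and \<Phi> :: "real ^ 'n \<Rightarrow> real \<Rightarrow> real ^ 'n"
    and p :: real
    and f :: "real ^ 'n \<Rightarrow> real"
  assumes "radon_measure \<mu>"
    and "open \<Omega>"
    and "\<exists>L. L-lipschitz_on UNIV F"
    and "flow_of F \<Phi>"
    and "flow_invariant \<mu> \<Phi>"
    and "1 \<le> p"
    and "f \<in> T_max_domain \<mu> \<Omega> \<Phi> p"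
  shows "(\<lambda>x. \<bar>f x\<bar> powr p) \<in> T_max_domain \<mu> \<Omega> \<Phi> 1 \<and>
         (AE x\<in>\<Omega> in \<mu>. T_max \<mu> \<Omega> \<Phi> 1 (\<lambda>x. \<bar>f x\<bar> powr p) x
            = p * sgn (f x) * \<bar>f x\<bar> powr (p - 1) * T_max \<mu> \<Omega> \<Phi> p f x)"
proof -
  obtain L where "L-lipschitz_on UNIV F" using assms(3) by blast
  interpret invariant_flow \<mu> \<Phi>
  proof
    show "\<Phi> x 0 = x" for x using assms(4) by (simp add: flow_of_def solves_ivp_def)
    show "\<Phi> (\<Phi> x s) t = \<Phi> x (s + t)" for x s t using assms(4) by (rule flow_of_group)
    show "continuous_on UNIV (\<lambda>z. \<Phi> (fst z) (snd z))"
      using \<open>L-lipschitz_on UNIV F\<close> assms(4) by (rule flow_of_jointly_continuous)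
  qed (use assms in auto)
  let ?G = "\<lambda>x. p * sgn (f x) * \<bar>f x\<bar> powr (p - 1) * T_max \<mu> \<Omega> \<Phi> p f x"
  obtain g where "T_max_rel \<mu> \<Omega> \<Phi> p f g"
    using assms(7) by (auto simp: T_max_domain_def)
  then have "T_max_rel \<mu> \<Omega> \<Phi> p f (T_max \<mu> \<Omega> \<Phi> p f)"
    unfolding T_max_def by (rule someI[of "T_max_rel \<mu> \<Omega> \<Phi> p f"])
  then have G: "T_max_rel \<mu> \<Omega> \<Phi> 1 (\<lambda>x. \<bar>f x\<bar> powr p) ?G"
    by (rule T_max_rel_abs_powr[OF assms(2,6)])
  then have "T_max_rel \<mu> \<Omega> \<Phi> 1 (\<lambda>x. \<bar>f x\<bar> powr p) (T_max \<mu> \<Omega> \<Phi> 1 (\<lambda>x. \<bar>f x\<bar> powr p))"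
    unfolding T_max_def[of _ _ _ 1] by (rule someI[of "T_max_rel \<mu> \<Omega> \<Phi> 1 (\<lambda>x. \<bar>f x\<bar> powr p)"])
  then show ?thesis
    using T_max_rel_unique[OF assms(2) _ G] G by (auto simp: T_max_domain_def)
qed

end
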